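(* Let $\varphi=\varphi(t,x)$, $t\in[0,T]$, be a path in $\operatorname{Diff}_{\mathcal S}(\mathbb R)$. Let $U$ be a neighbourhood of $\varphi$ in the space $\mathcal S([0,T]\times\mathbb R)$. Then there exists a path $\psi\in U$ with the same endpoints as $\varphi$, i.e. $\psi(0,\cdot)=\varphi(0,\cdot)$ and $\psi(T,\cdot)=\varphi(T,\cdot)$, and $$E(\psi)<E(\varphi),$$ where $E$ is the energy of a path with respect to the right-invariant $L^2$-metric.
   Context: $T>0$. $\mathcal S(\mathbb R)$ is the space of rapidly decreasing smooth functions on $\mathbb R$, topologized by the seminorms $\sum_{i\le m}\|(1+|x|^2)^k\partial_x^i f\|_\infty$, $k,m\in\mathbb N$ (with $0\in\mathbb N$). $\operatorname{Diff}_{\mathcal S}(\mathbb R)$ is the group, under composition, of diffeomorphisms of $\mathbb R$ of the form $\operatorname{Id}+f$ with $f\in\mathcal S(\mathbb R)$; all its elements have positive derivative. A path in $\operatorname{Diff}_{\mathcal S}(\mathbb R)$ is a smooth map $\varphi:[0,T]\times\mathbb R\to\mathbb R$ with $\varphi(t,\cdot)\in\operatorname{Diff}_{\mathcal S}(\mathbb R)$ for every $t$ and $\varphi(t,x)-x\in\mathcal S([0,T]\times\mathbb R)$. The topology of $\mathcal S([0,T]\times\mathbb R)$ is given by the seminorms $$\|h\|_{\mathcal S^{k,m,n}}=\sum_{i\le m,\ j\le n}\|(1+|x|^2)^k\partial_x^i\partial_t^j h\|_\infty,\qquad k,m,n\in\mathbb N,$$ and paths are topologized via $\varphi\mapsto\varphi-x$;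 thus closeness of paths $\varphi,\psi$ is measured by $\|\psi-\varphi\|_{\mathcal S^{k,m,n}}$. The energy of a path for the right-invariant $L^2$-metric is $$E(\varphi)=\int_0^T\int_{\mathbb R}\varphi_t(t,x)^2\,\varphi_x(t,x)\,dx\,dt .$$
   Formalization: The path φ is additionally assumed not to be constant in time; for a constant path E(φ)=0 while E(ψ)≥0 for every path ψ, so the claim as printed fails exactly there. *)

theory Defs
  imports "HOL-Analysis.Analysis"
begin

definition smooth_real :: "(real \<Rightarrow> real) \<Rightarrow> bool" where
  "smooth_real f \<longleftrightarrow> (\<forall>i x. (deriv ^^ i) f field_differentiable (at x))"

definition schwartz_seminorm :: "nat \<Rightarrow> nat \<Rightarrow> (real \<Rightarrow> real) \<Rightarrow> ennreal" where
  "schwartz_seminorm k m f =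
     (\<Sum>i\<le>m. SUP x. ennreal \<bar>(1 + \<bar>x\<bar>\<^sup>2) ^ k * (deriv ^^ i) f x\<bar>)"

definition schwartz :: "(real \<Rightarrow> real) set" where
  "schwartz = {f. smooth_real f \<and> (\<forall>k m. schwartz_seminorm k m f < \<infinity>)}"

definition diffeomorphism :: "(real \<Rightarrow> real) \<Rightarrow> bool" where
  "diffeomorphism g \<longleftrightarrow> bij g \<and> smooth_real g \<and> smooth_real (inv g)"

definition Diff_S :: "(real \<Rightarrow> real) set" where
  "Diff_S = {g. diffeomorphism g \<and> (\<exists>f\<in>schwartz. g = (\<lambda>x. x + f x))}"

text \<open>
  A function on the strip \<open>[0,T] \<times> \<real>\<close> is represented by a total curried function \<open>h t x\<close>.
  Values at times outside \<open>[0,T]\<close> play no role: the time derivative is taken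
  within \<open>[0,T]\<close>, hence is one-sided at the two end times, and all conditions,
  suprema and integrals below range over \<open>t \<in> [0,T]\<close> only.
\<close>

definition d_x :: "(real \<Rightarrow> real \<Rightarrow> real) \<Rightarrow> real \<Rightarrow> real \<Rightarrow> real" where
  "d_x h = (\<lambda>t x. deriv (h t) x)"

definition d_t :: "real \<Rightarrow> (real \<Rightarrow> real \<Rightarrow> real) \<Rightarrow> real \<Rightarrow> real \<Rightarrow> real" where
  "d_t T h = (\<lambda>t x. vector_derivative (\<lambda>s. h s x) (at t within {0..T}))"

primrec Ck_strip :: "real \<Rightarrow> nat \<Rightarrow> (real \<Rightarrow> real \<Rightarrow> real) \<Rightarrow> bool" where
  "Ck_strip T 0 h \<longleftrightarrow> continuous_on ({0..T} \<times> UNIV) (\<lambda>(t, x). h t x)"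
| "Ck_strip T (Suc k) h \<longleftrightarrow>
     continuous_on ({0..T} \<times> UNIV) (\<lambda>(t, x). h t x) \<and>
     (\<forall>t\<in>{0..T}. \<forall>x. (\<lambda>s. h s x) differentiable (at t within {0..T}) \<and>
                    h t field_differentiable (at x)) \<and>
     Ck_strip T k (d_t T h) \<and> Ck_strip T k (d_x h)"

definition smooth_strip :: "real \<Rightarrow> (real \<Rightarrow> real \<Rightarrow> real) \<Rightarrow> bool" where
  "smooth_strip T h \<longleftrightarrow> (\<forall>k. Ck_strip T k h)"

definition strip_seminorm :: "real \<Rightarrow> nat \<Rightarrow> nat \<Rightarrow> nat \<Rightarrow> (real \<Rightarrow> real \<Rightarrow> real) \<Rightarrow> ennreal" where
  "strip_seminorm T k m n h =
     (\<Sum>i\<le>m. \<Sum>j\<le>n. SUP (t, x)\<in>{0..T} \<times> UNIV.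
        ennreal \<bar>(1 + \<bar>x\<bar>\<^sup>2) ^ k * (d_x ^^ i) ((d_t T ^^ j) h) t x\<bar>)"

definition schwartz_strip :: "real \<Rightarrow> (real \<Rightarrow> real \<Rightarrow> real) set" where
  "schwartz_strip T = {h. smooth_strip T h \<and> (\<forall>k m n. strip_seminorm T k m n h < \<infinity>)}"

definition strip_ball ::
    "real \<Rightarrow> nat \<Rightarrow> nat \<Rightarrow> nat \<Rightarrow> (real \<Rightarrow> real \<Rightarrow> real) \<Rightarrow> real \<Rightarrow> (real \<Rightarrow> real \<Rightarrow> real) set" where
  "strip_ball T k m n h \<epsilon> =
     {g \<in> schwartz_strip T. strip_seminorm T k m n (\<lambda>t x. g t x - h t x) < ennreal \<epsilon>}"

definition schwartz_strip_topology :: "real \<Rightarrow> (real \<Rightarrow> real \<Rightarrow> real) topology" where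
  "schwartz_strip_topology T = topology_generated_by
     {strip_ball T k m n h \<epsilon> | k m n h \<epsilon>. h \<in> schwartz_strip T \<and> 0 < \<epsilon>}"

definition diff_paths :: "real \<Rightarrow> (real \<Rightarrow> real \<Rightarrow> real) set" where
  "diff_paths T = {\<phi>. smooth_strip T \<phi> \<and> (\<forall>t\<in>{0..T}. \<phi> t \<in> Diff_S) \<and>
                      (\<lambda>t x. \<phi> t x - x) \<in> schwartz_strip T}"

definition diff_path_topology :: "real \<Rightarrow> (real \<Rightarrow> real \<Rightarrow> real) topology" where
  "diff_path_topology T =
     pullback_topology (diff_paths T) (\<lambda>\<phi> t x. \<phi> t x - x) (schwartz_strip_topology T)"

definition energy :: "real \<Rightarrow> (real \<Rightarrow> real \<Rightarrow> real) \<Rightarrow> real" where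
  "energy T \<phi> = (LBINT t:{0..T}. (LBINT x. (d_t T \<phi> t x)\<^sup>2 * d_x \<phi> t x))"

end

theory Submission
  imports Defs "HOL-Probability.Sinc_Integral"
begin

text \<open>
  Along \<open>\<psi> = \<phi> + e \<eta>\<close> the energy is a cubic polynomial in \<open>e\<close>. The sign of \<open>e\<close> can be chosen so that the
  linear term is nonpositive, so it suffices to find \<open>\<eta>\<close>, smooth and supported in a small neighbourhood of a
  point \<open>(t0, x0)\<close> with \<open>0 < t0 < T\<close>, for which the quadratic coefficient
  \<open>\<integral>\<integral> \<phi>\<^sub>x \<eta>\<^sub>t\<^sup>2 + 2 \<phi>\<^sub>t \<eta>\<^sub>t \<eta>\<^sub>x\<close> is negative. As a quadratic form in \<open>(\<eta>\<^sub>t, \<eta>\<^sub>x)\<close> the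
  integrand is indefinite wherever \<open>\<phi>\<^sub>t \<noteq> 0\<close>, and such a point exists because the path is not constant.
  A bump that is very thin in a suitable direction has its gradient concentrated on the negative cone.
\<close>

text \<open>Nonconstancy is essential: \<open>d_x\<close> of a path is positive, so its energy is
  nonnegative, and a constant path has energy zero. With u = \<open>d_t T \<phi>\<close> and v =
  \<open>d_x \<phi>\<close>, the form v \<tau>^2 + 2 u \<tau> \<xi> is negative at (\<mu>, 1) once
  \<mu> has the sign opposite to u and is small: the term linear in \<mu> then beats the quadratic
  one. The obstacle is that a compactly supported bump cannot have its gradient in one direction
  only; cutting off along the thin strip produces an error. For a bump of width \<delta> the main
  part of the gradient has size 1/\<delta> and the error has size 1, both on a set of area of order
  \<delta>, so the two contributions to the quadratic coefficient are of orders -1/\<delta> and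
  \<delta>. The large derivatives of \<eta> do no harm: \<eta> is chosen before \<open>U\<close>
  enters, and both \<open>U\<close> and the requirement that the perturbed map stay increasing in x
  restrict only e.\<close>

subsection \<open>Smooth functions of one variable\<close>

text \<open>Smoothness cut off at a finite order, with the derivative peeled off at the inside, so
  that the product, chain and inverse rules can be proved by induction on the order.\<close>

primrec ndiff :: "nat \<Rightarrow> (real \<Rightarrow> real) \<Rightarrow> bool" where
  "ndiff 0 f \<longleftrightarrow> True"
| "ndiff (Suc n) f \<longleftrightarrow> (\<forall>x. f field_differentiable (at x)) \<and> ndiff n (deriv f)"

lemma ndiff_iff: "ndiff n f \<longleftrightarrow> (\<forall>i<n. \<forall>x. (deriv ^^ i) f field_differentiable (at x))"
proof (induction n arbitrary: f)
  case 0
  then show ?case by simp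
next
  case (Suc n)
  show ?case
    unfolding ndiff.simps Suc All_less_Suc2 by (simp add: funpow_swap1)
qed

lemma smooth_real_iff_ndiff: "smooth_real f \<longleftrightarrow> (\<forall>n. ndiff n f)"
  unfolding smooth_real_def ndiff_iff by blast

lemma ndiff_SucI:
  assumes "\<And>x. (f has_field_derivative f' x) (at x)" and "ndiff n f'"
  shows "ndiff (Suc n) f"
proof -
  have "deriv f = f'" using assms(1) DERIV_imp_deriv by blast
  then show ?thesis using assms by (auto simp: field_differentiable_def)
qed

lemma ndiff_Suc_has_deriv: "ndiff (Suc n) f \<Longrightarrow> (f has_field_derivative deriv f x) (at x)"
  by (simp add: DERIV_deriv_iff_field_differentiable)

lemma ndiff_Suc_imp: "ndiff (Suc n) f \<Longrightarrow> ndiff n f"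
  unfolding ndiff_iff by auto

lemma ndiff_add: "ndiff n f \<Longrightarrow> ndiff n g \<Longrightarrow> ndiff n (\<lambda>x. f x + g x)"
proof (induction n arbitrary: f g)
  case (Suc n)
  show ?case
    by (rule ndiff_SucI[where f' = "\<lambda>x. deriv f x + deriv g x"])
       (use Suc in \<open>auto intro!: DERIV_add simp: DERIV_deriv_iff_field_differentiable\<close>)
qed simp

lemma ndiff_const: "ndiff n (\<lambda>x. c)"
proof (induction n arbitrary: c)
  case (Suc n)
  show ?case by (rule ndiff_SucI[where f' = "\<lambda>x. 0"]) (use Suc in auto)
qed simp

lemma ndiff_mult: "ndiff n f \<Longrightarrow> ndiff n g \<Longrightarrow> ndiff n (\<lambda>x. f x * g x)"
proof (induction n arbitrary: f g)
  case (Suc n)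
  note fg = ndiff_Suc_has_deriv[OF Suc.prems(1)] ndiff_Suc_has_deriv[OF Suc.prems(2)]
  show ?case
  proof (rule ndiff_SucI[where f' = "\<lambda>x. deriv f x * g x + deriv g x * f x"])
    show "((\<lambda>x. f x * g x) has_field_derivative deriv f x * g x + deriv g x * f x) (at x)" for x
      by (rule DERIV_mult[OF fg])
    show "ndiff n (\<lambda>x. deriv f x * g x + deriv g x * f x)"
      using Suc.prems by (intro ndiff_add Suc.IH) (auto dest: ndiff_Suc_imp simp del: ndiff.simps(2), auto)
  qed
qed simp

lemma ndiff_compose: "ndiff n f \<Longrightarrow> ndiff n g \<Longrightarrow> ndiff n (\<lambda>x. f (g x))"
proof (induction n arbitrary: f g)
  case (Suc n)
  note fg = ndiff_Suc_has_deriv[OF Suc.prems(1)] ndiff_Suc_has_deriv[OF Suc.prems(2)]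
  show ?case
  proof (rule ndiff_SucI[where f' = "\<lambda>x. deriv f (g x) * deriv g x"])
    show "((\<lambda>x. f (g x)) has_field_derivative deriv f (g x) * deriv g x) (at x)" for x
      by (rule DERIV_chain2[OF fg])
    have "ndiff n (deriv f)" "ndiff n (deriv g)" using Suc.prems by auto
    then show "ndiff n (\<lambda>x. deriv f (g x) * deriv g x)"
      using ndiff_mult[OF Suc.IH] ndiff_Suc_imp[OF Suc.prems(2)] by blast
  qed
qed simp

text \<open>The derivative of 1/f is a product of f' and factors 1/f, so the induction hypothesis
  for 1/f itself closes the step.\<close>

lemma ndiff_inverse: "ndiff n f \<Longrightarrow> (\<And>x. f x \<noteq> 0) \<Longrightarrow> ndiff n (\<lambda>x. inverse (f x))"
proof (induction n)
  case (Suc n)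
  note f = ndiff_Suc_has_deriv[OF Suc.prems(1)]
  have IH: "ndiff n (\<lambda>x. inverse (f x))"
    using Suc.IH Suc.prems ndiff_Suc_imp by blast
  show ?case
  proof (rule ndiff_SucI[where f' = "\<lambda>x. (-1) * (inverse (f x) * (deriv f x * inverse (f x)))"])
    show "((\<lambda>x. inverse (f x)) has_field_derivative (-1) * (inverse (f x) * (deriv f x * inverse (f x)))) (at x)" for x
      using DERIV_inverse'[OF f Suc.prems(2)] by (simp add: mult.assoc)
    show "ndiff n (\<lambda>x. (-1) * (inverse (f x) * (deriv f x * inverse (f x))))"
      using Suc.prems(1) by (intro ndiff_mult ndiff_const IH) auto
  qed
qed simp

text \<open>Bootstrapping: the derivative of the inverse g is 1/f'(g), hence n orders of
  differentiability of g give n + 1.\<close>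

lemma smooth_real_inv:
  assumes f: "smooth_real f" and "bij f" and pos: "\<And>x. 0 < deriv f x"
  shows "smooth_real (inv f)"
proof -
  have df: "(f has_field_derivative deriv f x) (at x)" for x
    using f[unfolded smooth_real_iff_ndiff] ndiff_Suc_has_deriv by blast
  have fg: "f (inv f y) = y" and gf: "inv f (f x) = x" for x y
    using \<open>bij f\<close> by (auto simp: bij_is_surj surj_f_inv_f bij_is_inj)
  \<comment> \<open>The inverse function rule for derivatives takes continuity of the inverse as a
    premise, so it has to be secured first.\<close>
  have contg: "isCont (inv f) y" for y
    using isCont_inverse_function[of 1 "inv f y" "inv f" f] df[THEN DERIV_isCont] gf fg by simp
  have dg: "(inv f has_field_derivative inverse (deriv f (inv f y))) (at y)" for y
    by (rule DERIV_inverse_function[where a = "y - 1" and b = "y + 1"])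
       (use df contg fg pos less_imp_neq in \<open>auto simp: less_le\<close>)
  have "ndiff n (inv f)" for n
  proof (induction n)
    case (Suc n)
    have "ndiff (Suc n) f" using f by (simp add: smooth_real_iff_ndiff)
    then have "ndiff n (\<lambda>y. deriv f (inv f y))" using ndiff_compose[OF _ Suc] by simp
    then have "ndiff n (\<lambda>y. inverse (deriv f (inv f y)))"
      by (rule ndiff_inverse) (use pos less_imp_neq in \<open>auto simp: less_le\<close>)
    then show ?case by (rule ndiff_SucI[OF dg])
  qed simp
  then show ?thesis by (simp add: smooth_real_iff_ndiff)
qed

subsection \<open>A smooth bump function\<close>

definition flat :: "nat \<Rightarrow> real \<Rightarrow> real" where
  "flat n x = (if 0 < x then exp (- (1 / x)) / x ^ n else 0)"

lemma flat_tendsto_0: "(flat n \<longlongrightarrow> 0) (at 0)"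
proof (subst filterlim_at_split, intro conjI)
  show "(flat n \<longlongrightarrow> 0) (at_left 0)"
    by (rule tendsto_eventually) (auto simp: flat_def eventually_at_filter)
  have "((\<lambda>y::real. y ^ n / exp y) \<longlongrightarrow> 0) at_top" by (rule tendsto_power_div_exp_0)
  then have "((\<lambda>x::real. (inverse x) ^ n / exp (inverse x)) \<longlongrightarrow> 0) (at_right 0)"
    by (rule filterlim_compose) (rule filterlim_inverse_at_top_right)
  then show "(flat n \<longlongrightarrow> 0) (at_right 0)"
    by (rule Lim_transform_eventually)
       (auto simp: flat_def eventually_at_filter exp_minus field_simps)
qed

text \<open>The family is closed under differentiation up to linear combinations, which gives smoothness.\<close>
lemma flat_has_deriv:
  "(flat n has_field_derivative (- real n) * flat (Suc n) x + flat (Suc (Suc n)) x) (at x)"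
proof -
  consider "x < 0" | "x = 0" | "0 < x" by linarith
  then show ?thesis
  proof cases
    case 1
    have "((\<lambda>x. 0) has_field_derivative 0) (at x)" by simp
    then have "(flat n has_field_derivative 0) (at x)"
      by (rule has_field_derivative_transform_within_open[of _ _ _ "{..<0}"]) (use 1 in \<open>auto simp: flat_def\<close>)
    then show ?thesis using 1 by (simp add: flat_def)
  next
    case 2
    \<comment> \<open>The difference quotient of \<open>flat n\<close> at 0 is
      \<open>flat (Suc n)\<close>, whose limit at 0 is known.\<close>
    have "(flat n has_field_derivative 0) (at 0)"
      unfolding has_field_derivative_iff
      by (rule Lim_transform_eventually[OF flat_tendsto_0[of "Suc n"]])
         (auto simp: flat_def eventually_at_filter field_simps)
    then show ?thesis using 2 by (simp add: flat_def)
  next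
    case 3
    have "((\<lambda>x. exp (- (1 / x)) / x ^ n) has_field_derivative
       (- real n) * (exp (- (1 / x)) / x ^ Suc n) + exp (- (1 / x)) / x ^ Suc (Suc n)) (at x)"
    proof -
      have "real n * x ^ (n - Suc 0) = real n * x ^ n / x" using 3 by (cases n) auto
      then show ?thesis
        using 3 by (auto intro!: derivative_eq_intros simp: field_simps power2_eq_square)
    qed
    then have "(flat n has_field_derivative 
       (- real n) * (exp (- (1 / x)) / x ^ Suc n) + exp (- (1 / x)) / x ^ Suc (Suc n)) (at x)"
      by (rule has_field_derivative_transform_within_open[of _ _ _ "{0<..}"]) (use 3 in \<open>auto simp: flat_def\<close>)
    then show ?thesis using 3 by (simp add: flat_def)
  qed
qed

lemma ndiff_flat: "ndiff k (flat n)"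
proof (induction k arbitrary: n)
  case (Suc k)
  show ?case
    by (rule ndiff_SucI[OF flat_has_deriv]) (intro ndiff_add ndiff_mult ndiff_const Suc)
qed simp

lemma ndiff_affine: "ndiff k (\<lambda>x. a + b * x)"
proof (cases k)
  case (Suc n)
  show ?thesis unfolding Suc
    by (rule ndiff_SucI[where f' = "\<lambda>x. b"]) (auto intro!: derivative_eq_intros ndiff_const)
qed simp

lemma smooth_bump_exists:
  fixes r :: real
  assumes "0 < r"
  obtains b where "smooth_real b" "\<And>x. r \<le> \<bar>x\<bar> \<Longrightarrow> b x = 0" "b 0 \<noteq> 0"
proof
  \<comment> \<open>The first factor vanishes for x <= -r, the second for x >= r. The coefficients 1
    and -1 are written out to match \<open>ndiff_affine\<close>.\<close>
  define b where "b = (\<lambda>x. flat 0 (r + 1 * x) * flat 0 (r + (-1) * x))"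
  show "smooth_real b"
    unfolding smooth_real_iff_ndiff b_def
    using ndiff_mult ndiff_compose[OF ndiff_flat ndiff_affine] by blast
  show "b x = 0" if "r \<le> \<bar>x\<bar>" for x using that by (auto simp: b_def flat_def abs_if split: if_splits)
  show "b 0 \<noteq> 0" using assms by (simp add: b_def flat_def)
qed

lemma smooth_real_has_deriv: "smooth_real f \<Longrightarrow> (f has_field_derivative deriv f x) (at x)"
  unfolding smooth_real_iff_ndiff using ndiff_Suc_has_deriv by blast

lemma smooth_real_deriv: "smooth_real f \<Longrightarrow> smooth_real (deriv f)"
  unfolding smooth_real_iff_ndiff by (metis ndiff.simps(2))

lemma smooth_real_continuous: "smooth_real f \<Longrightarrow> continuous_on UNIV f"
  by (meson DERIV_continuous_on smooth_real_has_deriv has_field_derivative_at_within)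

text \<open>In the open exterior the function is locally zero; the boundary points, where this
  argument fails, follow from continuity of the derivative.\<close>

lemma smooth_real_deriv_eq_0:
  assumes "smooth_real f" "\<And>x. r \<le> \<bar>x\<bar> \<Longrightarrow> f x = 0" "r \<le> \<bar>x\<bar>"
  shows "deriv f x = 0"
proof (rule ccontr)
  assume "deriv f x \<noteq> 0"
  have out: "deriv f y = 0" if "r < \<bar>y\<bar>" for y
  proof -
    have "((\<lambda>x. 0) has_field_derivative 0) (at y)" by simp
    moreover have "open {y. r < \<bar>y\<bar>}" by (intro open_Collect_less continuous_intros)
    ultimately have "(f has_field_derivative 0) (at y)"
      by (rule has_field_derivative_transform_within_open) (use that assms(2) in auto)
    then show ?thesis by (rule DERIV_imp_deriv)
  qed
  have "continuous_on UNIV (deriv f)" using assms(1) smooth_real_continuous smooth_real_deriv by blast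
  then have "closed {y. deriv f y = 0}" 
    by (intro closed_Collect_eq) (auto intro: continuous_intros)
  then have "closure {y. r < \<bar>y\<bar>} \<subseteq> {y. deriv f y = 0}"
    by (intro closure_minimal) (use out in auto)
  moreover have "x \<in> closure {y. r < \<bar>y\<bar>}"
    unfolding closure_approachable
  proof safe
    fix e :: real assume "0 < e"
    then show "\<exists>y\<in>{y. r < \<bar>y\<bar>}. dist y x < e"
      \<comment> \<open>The witness moves x outward, away from 0, by half of the tolerance.\<close>
      using assms(3) by (intro bexI[where x = "x + (if 0 \<le> x then 1 else -1) * (e/2)"]) (auto simp: dist_real_def)
  qed
  ultimately show False using \<open>deriv f x \<noteq> 0\<close> by auto
qed

subsection \<open>Smooth functions on the strip\<close>

lemma has_deriv_d_t:
  assumes "(\<lambda>s. h s x) differentiable (at t within {0..T})"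
  shows "((\<lambda>s. h s x) has_real_derivative d_t T h t x) (at t within {0..T})"
  using assms unfolding d_t_def has_real_derivative_iff_has_vector_derivative
  by (simp add: vector_derivative_works)

text \<open>As the interval is nondegenerate, every time in it is a limit point, so the one-sided
  derivatives at the end times are unique too.\<close>

lemma d_t_eqI:
  assumes "0 < T" "t \<in> {0..T}"
    and "((\<lambda>s. h s x) has_real_derivative D) (at t within {0..T})"
  shows "d_t T h t x = D"
  unfolding d_t_def
  using assms vector_derivative_within_closed_interval has_real_derivative_iff_has_vector_derivative
  by blast

lemma d_x_eqI: "(h t has_real_derivative D) (at x) \<Longrightarrow> d_x h t x = D"
  unfolding d_x_def by (rule DERIV_imp_deriv)

lemma Ck_strip_continuous: "Ck_strip T k h \<Longrightarrow> continuous_on ({0..T} \<times> UNIV) (\<lambda>(t, x). h t x)"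
  by (cases k) auto

lemma Ck_strip_Suc_deriv_t:
  "Ck_strip T (Suc k) h \<Longrightarrow> t \<in> {0..T} \<Longrightarrow>
    ((\<lambda>s. h s x) has_real_derivative d_t T h t x) (at t within {0..T})"
  by (intro has_deriv_d_t) auto

lemma Ck_strip_Suc_deriv_x:
  "Ck_strip T (Suc k) h \<Longrightarrow> t \<in> {0..T} \<Longrightarrow> (h t has_real_derivative d_x h t x) (at x)"
  by (auto simp: d_x_def DERIV_deriv_iff_field_differentiable)

lemma d_t_cong:
  assumes "\<And>t x. t \<in> {0..T} \<Longrightarrow> f t x = g t x" "t \<in> {0..T}"
  shows "d_t T f t x = d_t T g t x"
  unfolding d_t_def
  by (rule vector_derivative_cong_eq)
     (use assms in \<open>auto simp: eventually_at_filter intro!: always_eventually\<close>)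

lemma d_x_cong:
  assumes "\<And>t x. t \<in> {0..T} \<Longrightarrow> f t x = g t x" "t \<in> {0..T}"
  shows "d_x f t x = d_x g t x"
proof -
  have "f t = g t" using assms by blast
  then show ?thesis by (simp add: d_x_def)
qed

lemma Ck_strip_SucI:
  assumes T: "0 < T" and "continuous_on ({0..T} \<times> UNIV) (\<lambda>(t, x). f t x)"
    and t: "\<And>t x. t \<in> {0..T} \<Longrightarrow> ((\<lambda>s. f s x) has_real_derivative ft t x) (at t within {0..T})"
    and x: "\<And>t x. t \<in> {0..T} \<Longrightarrow> (f t has_real_derivative fx t x) (at x)"
    and "Ck_strip T k (d_t T f)" "Ck_strip T k (d_x f)"
  shows "Ck_strip T (Suc k) f"
  unfolding Ck_strip.simps field_differentiable_def real_differentiable_def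
  using assms(2,5,6) t x by blast

text \<open>Formulas for \<open>d_t\<close> and \<open>d_x\<close> are available only at times in
  [0,T], so they never give equalities of total functions; this lemma lets them be used all the
  same.\<close>

lemma Ck_strip_cong:
  "(\<And>t x. t \<in> {0..T} \<Longrightarrow> f t x = g t x) \<Longrightarrow> Ck_strip T k f \<Longrightarrow> Ck_strip T k g"
proof (induction k arbitrary: f g)
  case 0
  have "continuous_on ({0..T} \<times> UNIV) (\<lambda>(t, x). f t x) = continuous_on ({0..T} \<times> UNIV) (\<lambda>(t, x). g t x)"
    by (rule continuous_on_cong) (use 0 in auto)
  then show ?case using 0 by simp
next
  case (Suc k)
  have "continuous_on ({0..T} \<times> UNIV) (\<lambda>(t, x). f t x) = continuous_on ({0..T} \<times> UNIV) (\<lambda>(t, x). g t x)"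
    by (rule continuous_on_cong) (use Suc in auto)
  moreover have "(\<lambda>s. g s x) differentiable (at t within {0..T})" if "t \<in> {0..T}" for t x
  proof -
    have "(\<lambda>s. f s x) differentiable (at t within {0..T})" using Suc.prems(2) that by auto
    then show ?thesis
      by (rule differentiable_transform_within[where d = 1]) (use Suc.prems(1) that in auto)
  qed
  moreover have "g t field_differentiable (at x)" if "t \<in> {0..T}" for t x
  proof -
    have "f t = g t" using Suc.prems(1) that by blast
    then show ?thesis using Suc.prems(2) that by (metis Ck_strip.simps(2))
  qed
  moreover have "Ck_strip T k (d_t T g)"
    by (rule Suc.IH[of "d_t T f"]) (use Suc.prems in \<open>auto intro!: d_t_cong\<close>)
  moreover have "Ck_strip T k (d_x g)"
    by (rule Suc.IH[of "d_x f"]) (use Suc.prems in \<open>auto intro!: d_x_cong\<close>)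
  ultimately show ?case using Suc.prems by simp
qed

text \<open>Allows explicit formulas in place of \<open>d_t T f\<close> and \<open>d_x f\<close>;
  all closure properties below are inductions through this rule.\<close>

lemma Ck_strip_SucI':
  assumes T: "0 < T" and "continuous_on ({0..T} \<times> UNIV) (\<lambda>(t, x). f t x)"
    and t: "\<And>t x. t \<in> {0..T} \<Longrightarrow> ((\<lambda>s. f s x) has_real_derivative ft t x) (at t within {0..T})"
    and x: "\<And>t x. t \<in> {0..T} \<Longrightarrow> (f t has_real_derivative fx t x) (at x)"
    and "Ck_strip T k ft" "Ck_strip T k fx"
  shows "Ck_strip T (Suc k) f"
proof (rule Ck_strip_SucI[OF T assms(2) t x])
  show "Ck_strip T k (d_t T f)"
    by (rule Ck_strip_cong[OF _ assms(5)]) (use d_t_eqI[OF T _ t] in auto)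
  show "Ck_strip T k (d_x f)"
    by (rule Ck_strip_cong[OF _ assms(6)]) (use d_x_eqI[where h = f, OF x] in auto)
qed

lemma Ck_strip_Suc_imp: "Ck_strip T (Suc k) f \<Longrightarrow> Ck_strip T k f"
proof (induction k arbitrary: f)
  case 0
  then show ?case by simp
next
  case (Suc k)
  have "Ck_strip T k (d_t T f)" "Ck_strip T k (d_x f)"
    using Suc.prems by (auto intro!: Suc.IH simp del: Ck_strip.simps(2), auto)
  then show ?case using Suc.prems by auto
qed

lemma Ck_strip_add:
  assumes "0 < T"
  shows "Ck_strip T k f \<Longrightarrow> Ck_strip T k g \<Longrightarrow> Ck_strip T k (\<lambda>t x. f t x + g t x)"
proof (induction k arbitrary: f g)
  case 0
  then show ?case by (auto simp: split_beta intro!: continuous_intros)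
next
  case (Suc k)
  show ?case
  proof (rule Ck_strip_SucI'[OF assms])
    show "continuous_on ({0..T} \<times> UNIV) (\<lambda>(t, x). f t x + g t x)"
      using Suc.prems by (auto simp: split_beta intro!: continuous_intros)
    show "((\<lambda>s. f s x + g s x) has_real_derivative d_t T f t x + d_t T g t x) (at t within {0..T})"
      if "t \<in> {0..T}" for t x
      using Suc.prems[THEN Ck_strip_Suc_deriv_t, OF that] by (rule DERIV_add)
    show "((\<lambda>x. f t x + g t x) has_real_derivative d_x f t x + d_x g t x) (at x)"
      if "t \<in> {0..T}" for t x
      using Suc.prems[THEN Ck_strip_Suc_deriv_x, OF that] by (rule DERIV_add)
  qed (use Suc in auto)
qed

lemma Ck_strip_const:
  assumes "0 < T"
  shows "Ck_strip T k (\<lambda>t x. c)"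
proof (induction k arbitrary: c)
  case (Suc k)
  show ?case
    by (rule Ck_strip_SucI'[OF assms, where ft = "\<lambda>t x. 0" and fx = "\<lambda>t x. 0"])
       (use Suc in \<open>auto intro!: continuous_intros simp: split_beta\<close>)
qed (simp add: split_beta)

lemma Ck_strip_mult:
  assumes "0 < T"
  shows "Ck_strip T k f \<Longrightarrow> Ck_strip T k g \<Longrightarrow> Ck_strip T k (\<lambda>t x. f t x * g t x)"
proof (induction k arbitrary: f g)
  case 0
  then show ?case by (auto simp: split_beta intro!: continuous_intros)
next
  case (Suc k)
  show ?case
  proof (rule Ck_strip_SucI'[OF assms])
    show "continuous_on ({0..T} \<times> UNIV) (\<lambda>(t, x). f t x * g t x)"
      using Suc.prems by (auto simp: split_beta intro!: continuous_intros)
    show "((\<lambda>s. f s x * g s x) has_real_derivative d_t T f t x * g t x + d_t T g t x * f t x) (at t within {0..T})"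
      if "t \<in> {0..T}" for t x
      using Suc.prems[THEN Ck_strip_Suc_deriv_t, OF that] by (rule DERIV_mult)
    show "((\<lambda>x. f t x * g t x) has_real_derivative d_x f t x * g t x + d_x g t x * f t x) (at x)"
      if "t \<in> {0..T}" for t x
      using Suc.prems[THEN Ck_strip_Suc_deriv_x, OF that] by (rule DERIV_mult)
    have "Ck_strip T k f" "Ck_strip T k g" using Suc.prems Ck_strip_Suc_imp by blast+
    moreover have "Ck_strip T k (d_t T f)" "Ck_strip T k (d_t T g)" "Ck_strip T k (d_x f)" "Ck_strip T k (d_x g)"
      using Suc.prems by auto
    ultimately show "Ck_strip T k (\<lambda>t x. d_t T f t x * g t x + d_t T g t x * f t x)"
      "Ck_strip T k (\<lambda>t x. d_x f t x * g t x + d_x g t x * f t x)"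
      using Ck_strip_add[OF assms Suc.IH Suc.IH] by blast+
  qed
qed

text \<open>The source of smoothness for the perturbation, which will be a product of two
  one-variable bumps composed with affine functions of (t, x).\<close>

lemma Ck_strip_compose_affine:
  assumes "0 < T"
  shows "smooth_real f \<Longrightarrow> Ck_strip T k (\<lambda>t x. f (a + b * t + c * x))"
proof (induction k arbitrary: f)
  case 0
  then have "continuous_on UNIV f" by (rule smooth_real_continuous)
  then show ?case
    by (auto simp: split_beta intro!: continuous_intros continuous_on_compose2[of UNIV f])
next
  case (Suc k)
  have cont: "continuous_on UNIV f" using Suc.prems by (rule smooth_real_continuous)
  note df = smooth_real_has_deriv[OF Suc.prems, THEN DERIV_chain2]
  show ?case
  proof (rule Ck_strip_SucI'[OF assms])
    show "continuous_on ({0..T} \<times> UNIV) (\<lambda>(t, x). f (a + b * t + c * x))"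
      using cont by (auto simp: split_beta intro!: continuous_intros continuous_on_compose2[of UNIV f])
    show "((\<lambda>s. f (a + b * s + c * x)) has_real_derivative b * deriv f (a + b * t + c * x)) (at t within {0..T})"
      if "t \<in> {0..T}" for t x
      by (rule DERIV_cong[OF df]) (auto intro!: derivative_eq_intros)
    show "((\<lambda>x. f (a + b * t + c * x)) has_real_derivative c * deriv f (a + b * t + c * x)) (at x)"
      if "t \<in> {0..T}" for t x
      by (rule DERIV_cong[OF df]) (auto intro!: derivative_eq_intros)
    have "Ck_strip T k (\<lambda>t x. deriv f (a + b * t + c * x))"
      by (rule Suc.IH) (rule smooth_real_deriv[OF Suc.prems])
    then show "Ck_strip T k (\<lambda>t x. b * deriv f (a + b * t + c * x))"
      "Ck_strip T k (\<lambda>t x. c * deriv f (a + b * t + c * x))"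
      using Ck_strip_mult[OF assms Ck_strip_const[OF assms]] by blast+
  qed
qed

lemma smooth_strip_d_t: "smooth_strip T h \<Longrightarrow> smooth_strip T (d_t T h)"
  unfolding smooth_strip_def by (metis Ck_strip.simps(2))

lemma smooth_strip_d_x: "smooth_strip T h \<Longrightarrow> smooth_strip T (d_x h)"
  unfolding smooth_strip_def by (metis Ck_strip.simps(2))

lemma smooth_strip_iter_d_t: "smooth_strip T h \<Longrightarrow> smooth_strip T ((d_t T ^^ j) h)"
  by (induction j) (auto intro: smooth_strip_d_t)

lemma smooth_strip_iter_d_x: "smooth_strip T h \<Longrightarrow> smooth_strip T ((d_x ^^ j) h)"
  by (induction j) (auto intro: smooth_strip_d_x)

lemma smooth_strip_deriv_t:
  "smooth_strip T h \<Longrightarrow> t \<in> {0..T} \<Longrightarrow>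
    ((\<lambda>s. h s x) has_real_derivative d_t T h t x) (at t within {0..T})"
  unfolding smooth_strip_def using Ck_strip_Suc_deriv_t by blast

lemma smooth_strip_deriv_x:
  "smooth_strip T h \<Longrightarrow> t \<in> {0..T} \<Longrightarrow> (h t has_real_derivative d_x h t x) (at x)"
  unfolding smooth_strip_def using Ck_strip_Suc_deriv_x by blast

lemma smooth_strip_continuous:
  "smooth_strip T h \<Longrightarrow> continuous_on ({0..T} \<times> UNIV) (\<lambda>(t, x). h t x)"
  unfolding smooth_strip_def using Ck_strip_continuous by blast

text \<open>The shape f + c g covers both differences (c = -1) and perturbations (c = e), so it is
  the only linear combination treated.\<close>

lemma smooth_strip_add_cmult:
  assumes "0 < T" "smooth_strip T f" "smooth_strip T g"
  shows "smooth_strip T (\<lambda>t x. f t x + c * g t x)"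
  unfolding smooth_strip_def
proof
  fix k
  show "Ck_strip T k (\<lambda>t x. f t x + c * g t x)"
    using Ck_strip_add[OF assms(1) _ Ck_strip_mult[OF assms(1) Ck_strip_const[OF assms(1)]]] assms(2,3)
    unfolding smooth_strip_def by blast
qed

lemma d_t_add_cmult:
  assumes "0 < T" "smooth_strip T f" "smooth_strip T g" "t \<in> {0..T}"
  shows "d_t T (\<lambda>t x. f t x + c * g t x) t x = d_t T f t x + c * d_t T g t x"
proof (rule d_t_eqI[OF assms(1,4)])
  show "((\<lambda>s. f s x + c * g s x) has_real_derivative d_t T f t x + c * d_t T g t x) (at t within {0..T})"
    by (intro DERIV_add DERIV_cmult smooth_strip_deriv_t assms)
qed

lemma d_x_add_cmult:
  assumes "smooth_strip T f" "smooth_strip T g" "t \<in> {0..T}"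
  shows "d_x (\<lambda>t x. f t x + c * g t x) t x = d_x f t x + c * d_x g t x"
proof (rule d_x_eqI)
  show "((\<lambda>x. f t x + c * g t x) has_real_derivative d_x f t x + c * d_x g t x) (at x)"
    using assms by (intro DERIV_add DERIV_cmult) (auto intro: smooth_strip_deriv_x)
qed

text \<open>The separate function \<open>h\<close>, tied to the combination only on the strip, keeps
  the induction going: after one derivative the identity survives only for times in [0,T].\<close>

lemma iter_d_t_add_cmult:
  assumes "0 < T"
  shows "smooth_strip T f \<Longrightarrow> smooth_strip T g \<Longrightarrow>
    (\<And>t x. t \<in> {0..T} \<Longrightarrow> h t x = f t x + c * g t x) \<Longrightarrow> t \<in> {0..T} \<Longrightarrow>
    (d_t T ^^ j) h t x = (d_t T ^^ j) f t x + c * (d_t T ^^ j) g t x"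
proof (induction j arbitrary: f g h t x)
  case (Suc j)
  have "d_t T h t x = d_t T f t x + c * d_t T g t x" if "t \<in> {0..T}" for t x
    using d_t_cong[of T h, OF Suc.prems(3) that] d_t_add_cmult[OF assms Suc.prems(1,2) that] by simp
  from Suc.IH[OF Suc.prems(1,2)[THEN smooth_strip_d_t] this Suc.prems(4)] show ?case
    by (simp add: funpow_swap1)
qed simp

lemma iter_d_x_add_cmult:
  shows "smooth_strip T f \<Longrightarrow> smooth_strip T g \<Longrightarrow>
    (\<And>t x. t \<in> {0..T} \<Longrightarrow> h t x = f t x + c * g t x) \<Longrightarrow> t \<in> {0..T} \<Longrightarrow>
    (d_x ^^ j) h t x = (d_x ^^ j) f t x + c * (d_x ^^ j) g t x"
proof (induction j arbitrary: f g h t x)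
  case (Suc j)
  have "d_x h t x = d_x f t x + c * d_x g t x" if "t \<in> {0..T}" for t x
    using d_x_cong[of T h, OF Suc.prems(3) that] d_x_add_cmult[OF Suc.prems(1,2) that] by simp
  from Suc.IH[OF Suc.prems(1,2)[THEN smooth_strip_d_x] this Suc.prems(4)] show ?case
    by (simp add: funpow_swap1)
qed simp

section \<open>Seminorm estimates and rapid decay\<close>

lemma strip_seminorm_add_cmult:
  assumes T: "0 < T" and f: "smooth_strip T f" and g: "smooth_strip T g"
  shows "strip_seminorm T k m n (\<lambda>t x. f t x + c * g t x)
    \<le> strip_seminorm T k m n f + ennreal \<bar>c\<bar> * strip_seminorm T k m n g"
proof -
  define D where "D i j h = (d_x ^^ i) ((d_t T ^^ j) h)" for i j h
  define S where "S i j h = (SUP (t, x)\<in>{0..T} \<times> UNIV. ennreal \<bar>(1 + \<bar>x\<bar>\<^sup>2) ^ k * D i j h t x\<bar>)" for i j h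
  have S_upper: "ennreal \<bar>(1 + \<bar>x\<bar>\<^sup>2) ^ k * D i j h t x\<bar> \<le> S i j h" if "t \<in> {0..T}" for t x i j h
    unfolding S_def by (rule SUP_upper2[of "(t, x)"]) (use that in auto)
  have "S i j (\<lambda>t x. f t x + c * g t x) \<le> S i j f + ennreal \<bar>c\<bar> * S i j g" for i j
  proof -
    have "ennreal \<bar>(1 + \<bar>x\<bar>\<^sup>2) ^ k * D i j (\<lambda>t x. f t x + c * g t x) t x\<bar> \<le> S i j f + ennreal \<bar>c\<bar> * S i j g"
      if t: "t \<in> {0..T}" for t x
    proof -
      have "D i j (\<lambda>t x. f t x + c * g t x) t x = D i j f t x + c * D i j g t x"
        unfolding D_def
        by (rule iter_d_x_add_cmult[OF smooth_strip_iter_d_t[OF f] smooth_strip_iter_d_t[OF g]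
              iter_d_t_add_cmult[OF T f g]]) (use t in auto)
      then have "ennreal \<bar>(1 + \<bar>x\<bar>\<^sup>2) ^ k * D i j (\<lambda>t x. f t x + c * g t x) t x\<bar>
          \<le> ennreal (\<bar>(1 + \<bar>x\<bar>\<^sup>2) ^ k * D i j f t x\<bar> + \<bar>c\<bar> * \<bar>(1 + \<bar>x\<bar>\<^sup>2) ^ k * D i j g t x\<bar>)"
        using abs_triangle_ineq[of "(1 + \<bar>x\<bar>\<^sup>2) ^ k * D i j f t x" "c * ((1 + \<bar>x\<bar>\<^sup>2) ^ k * D i j g t x)"]
        by (intro ennreal_leI) (simp add: algebra_simps abs_mult)
      also have "\<dots> = ennreal \<bar>(1 + \<bar>x\<bar>\<^sup>2) ^ k * D i j f t x\<bar> + ennreal \<bar>c\<bar> * ennreal \<bar>(1 + \<bar>x\<bar>\<^sup>2) ^ k * D i j g t x\<bar>"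
        by (simp add: ennreal_plus ennreal_mult)
      also have "\<dots> \<le> S i j f + ennreal \<bar>c\<bar> * S i j g"
        by (intro add_mono mult_left_mono S_upper t) auto
      finally show ?thesis .
    qed
    then show ?thesis unfolding S_def[of i j "\<lambda>t x. f t x + c * g t x"] by (auto intro!: SUP_least)
  qed
  then have "(\<Sum>i\<le>m. \<Sum>j\<le>n. S i j (\<lambda>t x. f t x + c * g t x))
      \<le> (\<Sum>i\<le>m. \<Sum>j\<le>n. S i j f + ennreal \<bar>c\<bar> * S i j g)"
    by (intro sum_mono)
  then show ?thesis
    unfolding strip_seminorm_def S_def D_def by (simp add: sum.distrib sum_distrib_left)
qed

lemma schwartz_strip_add_cmult:
  assumes "0 < T" "f \<in> schwartz_strip T" "g \<in> schwartz_strip T"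
  shows "(\<lambda>t x. f t x + c * g t x) \<in> schwartz_strip T"
proof -
  have "strip_seminorm T k m n (\<lambda>t x. f t x + c * g t x) < \<infinity>" for k m n
    using strip_seminorm_add_cmult[OF assms(1), of f g k m n c] assms
    by (auto simp: schwartz_strip_def ennreal_mult_less_top elim!: le_less_trans)
  then show ?thesis
    using assms smooth_strip_add_cmult by (auto simp: schwartz_strip_def)
qed

text \<open>The supremum for orders i and j is one summand of a finite seminorm, hence finite and
  expressible as a real constant.\<close>

lemma schwartz_strip_bound:
  assumes "h \<in> schwartz_strip T"
  obtains C where "0 \<le> C" "\<And>t x. t \<in> {0..T} \<Longrightarrow> (1 + x\<^sup>2) ^ k * \<bar>(d_x ^^ i) ((d_t T ^^ j) h) t x\<bar> \<le> C"
proof -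
  define s where "s = (SUP (t, x)\<in>{0..T} \<times> UNIV. ennreal \<bar>(1 + \<bar>x\<bar>\<^sup>2) ^ k * (d_x ^^ i) ((d_t T ^^ j) h) t x\<bar>)"
  have "s \<le> (\<Sum>j\<le>j. SUP (t, x)\<in>{0..T} \<times> UNIV. ennreal \<bar>(1 + \<bar>x\<bar>\<^sup>2) ^ k * (d_x ^^ i) ((d_t T ^^ j) h) t x\<bar>)"
    unfolding s_def by (rule member_le_sum[where i = j]) auto
  also have "\<dots> \<le> strip_seminorm T k i j h"
    unfolding strip_seminorm_def by (rule member_le_sum[where i = i]) auto
  also have "\<dots> < \<infinity>" using assms by (auto simp: schwartz_strip_def)
  finally have s: "s < \<infinity>" .
  have "(1 + x\<^sup>2) ^ k * \<bar>(d_x ^^ i) ((d_t T ^^ j) h) t x\<bar> \<le> enn2real s" if "t \<in> {0..T}" for t x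
  proof -
    have "ennreal \<bar>(1 + \<bar>x\<bar>\<^sup>2) ^ k * (d_x ^^ i) ((d_t T ^^ j) h) t x\<bar> \<le> s"
      unfolding s_def by (rule SUP_upper2[of "(t, x)"]) (use that in auto)
    then have "\<bar>(1 + \<bar>x\<bar>\<^sup>2) ^ k * (d_x ^^ i) ((d_t T ^^ j) h) t x\<bar> \<le> enn2real s"
      using s by (metis abs_ge_zero enn2real_ennreal enn2real_mono infinity_ennreal_def)
    then show ?thesis by (simp add: abs_mult)
  qed
  then show ?thesis by (rule that[OF enn2real_nonneg])
qed

lemma iter_d_t_eq_0:
  assumes "0 < T"
  shows "(\<And>t x. t \<in> {0..T} \<Longrightarrow> R < \<bar>x\<bar> \<Longrightarrow> h t x = 0) \<Longrightarrow> t \<in> {0..T} \<Longrightarrow> R < \<bar>x\<bar> \<Longrightarrow>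
    (d_t T ^^ j) h t x = 0"
proof (induction j arbitrary: h t x)
  case (Suc j)
  have "d_t T h t x = 0" if "t \<in> {0..T}" "R < \<bar>x\<bar>" for t x
  proof (rule d_t_eqI[OF assms that(1)])
    have "((\<lambda>s. 0) has_real_derivative 0) (at t within {0..T})" by simp
    then show "((\<lambda>s. h s x) has_real_derivative 0) (at t within {0..T})"
      by (rule has_field_derivative_transform_within[where d = 1]) (use Suc.prems(1) that in auto)
  qed
  from Suc.IH[OF this Suc.prems(2,3)] show ?case by (simp add: funpow_swap1)
qed simp

text \<open>The strict inequality makes the vanishing region open in x, so vanishing passes to
  x-derivatives.\<close>

lemma iter_d_x_eq_0:
  shows "(\<And>t x. t \<in> {0..T} \<Longrightarrow> R < \<bar>x\<bar> \<Longrightarrow> h t x = 0) \<Longrightarrow> t \<in> {0..T} \<Longrightarrow> R < \<bar>x\<bar> \<Longrightarrow>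
    (d_x ^^ j) h t x = 0"
proof (induction j arbitrary: h t x)
  case (Suc j)
  have "d_x h t x = 0" if "t \<in> {0..T}" "R < \<bar>x\<bar>" for t x
  proof (rule d_x_eqI)
    have "((\<lambda>s. 0) has_real_derivative 0) (at x)" by simp
    moreover have "open {y::real. R < \<bar>y\<bar>}" by (intro open_Collect_less continuous_intros)
    ultimately show "(h t has_real_derivative 0) (at x)"
      by (rule has_field_derivative_transform_within_open) (use Suc.prems(1) that in auto)
  qed
  from Suc.IH[OF this Suc.prems(2,3)] show ?case by (simp add: funpow_swap1)
qed simp

text \<open>Weighted derivatives are continuous, hence bounded on a compact rectangle, and vanish
  beyond it.\<close>

lemma schwartz_strip_compact_support:
  assumes T: "0 < T" and h: "smooth_strip T h"
    and supp: "\<And>t x. t \<in> {0..T} \<Longrightarrow> R < \<bar>x\<bar> \<Longrightarrow> h t x = 0"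
  shows "h \<in> schwartz_strip T"
proof -
  have "(SUP (t, x)\<in>{0..T} \<times> UNIV. ennreal \<bar>(1 + \<bar>x\<bar>\<^sup>2) ^ k * (d_x ^^ i) ((d_t T ^^ j) h) t x\<bar>) < \<infinity>" for k i j
  proof -
    define F where "F = (\<lambda>(t, x). (1 + \<bar>x\<bar>\<^sup>2) ^ k * (d_x ^^ i) ((d_t T ^^ j) h) t x)"
    have "continuous_on ({0..T} \<times> UNIV) (\<lambda>(t, x). (d_x ^^ i) ((d_t T ^^ j) h) t x)"
      by (intro smooth_strip_continuous smooth_strip_iter_d_x smooth_strip_iter_d_t h)
    then have "continuous_on ({0..T} \<times> UNIV) F"
      unfolding F_def split_beta by (intro continuous_intros)
    then have "continuous_on ({0..T} \<times> {-R..R}) F" by (rule continuous_on_subset) auto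
    then have "bounded (F ` ({0..T} \<times> {-R..R}))"
      by (intro compact_imp_bounded compact_continuous_image compact_Times) auto
    then obtain B where B: "\<And>p. p \<in> {0..T} \<times> {-R..R} \<Longrightarrow> \<bar>F p\<bar> \<le> B"
      by (auto simp: bounded_iff)
    \<comment> \<open>\<open>B\<close> only bounds on the rectangle, and may be negative if that is
      empty; outside it the value is 0.\<close>
    have "\<bar>F (t, x)\<bar> \<le> max B 0" if "t \<in> {0..T}" for t x
    proof (cases "R < \<bar>x\<bar>")
      case True
      then have "(d_x ^^ i) ((d_t T ^^ j) h) t x = 0"
        using iter_d_x_eq_0[of T R "(d_t T ^^ j) h"] iter_d_t_eq_0[OF T, of R h] supp that by blast
      then show ?thesis by (simp add: F_def)
    next
      case False
      then have "\<bar>F (t, x)\<bar> \<le> B" using that by (intro B) auto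
      then show ?thesis by simp
    qed
    then have "(SUP (t, x)\<in>{0..T} \<times> UNIV. ennreal \<bar>(1 + \<bar>x\<bar>\<^sup>2) ^ k * (d_x ^^ i) ((d_t T ^^ j) h) t x\<bar>)
       \<le> ennreal (max B 0)"
      by (intro SUP_least) (auto simp: F_def intro!: ennreal_leI)
    then show ?thesis unfolding infinity_ennreal_def by (rule le_less_trans) (rule ennreal_less_top)
  qed
  then show ?thesis
    using h by (auto simp: schwartz_strip_def strip_seminorm_def)
qed

text \<open>All that is used of the topology: a short segment through f in direction g stays inside
  an open set. This property passes to finite intersections and unions, so it only has to be checked
  on the generating balls.\<close>

lemma schwartz_strip_topology_line:
  assumes T: "0 < T" and W: "openin (schwartz_strip_topology T) W" and f: "f \<in> W"
    and g: "g \<in> schwartz_strip T"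
  obtains d where "0 < d" "\<And>c. \<bar>c\<bar> < d \<Longrightarrow> (\<lambda>t x. f t x + c * g t x) \<in> W"
proof -
  have "generate_topology_on {strip_ball T k m n h \<epsilon> | k m n h \<epsilon>. h \<in> schwartz_strip T \<and> 0 < \<epsilon>} W"
    using W by (simp add: schwartz_strip_topology_def openin_topology_generated_by_iff)
  then have "\<forall>f\<in>W. \<exists>d>0. \<forall>c. \<bar>c\<bar> < d \<longrightarrow> (\<lambda>t x. f t x + c * g t x) \<in> W"
  proof induction
    case (Int a b)
    show ?case
    proof
      fix f assume "f \<in> a \<inter> b"
      then obtain d1 d2 where "d1 > 0" "\<forall>c. \<bar>c\<bar> < d1 \<longrightarrow> (\<lambda>t x. f t x + c * g t x) \<in> a"
        "d2 > 0" "\<forall>c. \<bar>c\<bar> < d2 \<longrightarrow> (\<lambda>t x. f t x + c * g t x) \<in> b"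
        using Int.IH[THEN bspec, of f] by blast
      then show "\<exists>d>0. \<forall>c. \<bar>c\<bar> < d \<longrightarrow> (\<lambda>t x. f t x + c * g t x) \<in> a \<inter> b"
        by (intro exI[of _ "min d1 d2"]) auto
    qed
  next
    case (UN K)
    show ?case
    proof
      fix f assume "f \<in> \<Union>K"
      then obtain k where k: "k \<in> K" "f \<in> k" by blast
      then obtain d where "d > 0" "\<forall>c. \<bar>c\<bar> < d \<longrightarrow> (\<lambda>t x. f t x + c * g t x) \<in> k"
        using UN.IH[OF k(1), THEN bspec, of f] by blast
      then show "\<exists>d>0. \<forall>c. \<bar>c\<bar> < d \<longrightarrow> (\<lambda>t x. f t x + c * g t x) \<in> \<Union>K"
        using k(1) by blast
    qed
  next
    case (Basis s)
    then obtain k m n h \<epsilon> where s: "s = strip_ball T k m n h \<epsilon>" and h: "h \<in> schwartz_strip T" by auto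
    show ?case
    proof
      fix f assume "f \<in> s"
      then have f: "f \<in> schwartz_strip T"
        and fh: "strip_seminorm T k m n (\<lambda>t x. f t x - h t x) < ennreal \<epsilon>"
        by (auto simp: s strip_ball_def)
      have smooth: "smooth_strip T (\<lambda>t x. f t x - h t x)"
        using smooth_strip_add_cmult[OF T, of f h "-1"] f h by (auto simp: schwartz_strip_def)
      define a where "a = strip_seminorm T k m n (\<lambda>t x. f t x - h t x)"
      define b where "b = strip_seminorm T k m n g"
      have "b < \<infinity>" using g by (auto simp: b_def schwartz_strip_def)
      then obtain B where B: "0 \<le> B" "b = ennreal B" by (cases b) auto
      have "a < \<infinity>" using fh by (auto simp: a_def elim: less_trans)
      then obtain A where A: "0 \<le> A" "a = ennreal A" by (cases a) auto
      have "A < \<epsilon>" using fh A by (simp add: a_def[symmetric] ennreal_less_iff)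
      \<comment> \<open>The ball is centred at h, not at f: \<open>A\<close> is the distance already
        used up, and \<epsilon> - A is left for moving along g. Adding 1 avoids dividing by
        zero.\<close>
      define d where "d = (\<epsilon> - A) / (B + 1)"
      have "0 < d" using \<open>A < \<epsilon>\<close> B by (simp add: d_def)
      moreover have "(\<lambda>t x. f t x + c * g t x) \<in> s" if c: "\<bar>c\<bar> < d" for c
      proof -
        have "\<bar>c\<bar> * B \<le> \<bar>c\<bar> * (B + 1)" by (simp add: mult_left_mono)
        also have "\<dots> < d * (B + 1)" using c B by simp
        also have "\<dots> = \<epsilon> - A" using B by (simp add: d_def)
        finally have "A + \<bar>c\<bar> * B < \<epsilon>" by simp
        have "strip_seminorm T k m n (\<lambda>t x. (f t x - h t x) + c * g t x) \<le> a + ennreal \<bar>c\<bar> * b"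
          unfolding a_def b_def
          by (rule strip_seminorm_add_cmult[OF T smooth]) (use g in \<open>auto simp: schwartz_strip_def\<close>)
        also have "\<dots> = ennreal (A + \<bar>c\<bar> * B)"
          using A B by (simp add: ennreal_plus ennreal_mult)
        also have "\<dots> < ennreal \<epsilon>"
          using \<open>A + \<bar>c\<bar> * B < \<epsilon>\<close> A B by (subst ennreal_less_iff) auto
        finally have "strip_seminorm T k m n (\<lambda>t x. (f t x - h t x) + c * g t x) < ennreal \<epsilon>" .
        moreover have "(\<lambda>t x. (f t x - h t x) + c * g t x) = (\<lambda>t x. f t x + c * g t x - h t x)"
          by (intro ext) simp
        ultimately show ?thesis
          unfolding s strip_ball_def using schwartz_strip_add_cmult[OF T f g] by simp
      qed
      ultimately show "\<exists>d>0. \<forall>c. \<bar>c\<bar> < d \<longrightarrow> (\<lambda>t x. f t x + c * g t x) \<in> s" by blast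
    qed
  qed simp
  then show ?thesis using f that by blast
qed

subsection \<open>Diffeomorphisms\<close>

lemma iter_d_x_slice: "(d_x ^^ i) h t = (deriv ^^ i) (h t)"
proof (induction i)
  case (Suc i)
  have "(d_x ^^ Suc i) h t = deriv ((d_x ^^ i) h t)" by (simp add: d_x_def)
  then show ?case using Suc by simp
qed simp

lemma smooth_strip_slice:
  assumes "smooth_strip T h" "t \<in> {0..T}"
  shows "smooth_real (h t)"
  unfolding smooth_real_def iter_d_x_slice[symmetric] field_differentiable_def
  using smooth_strip_deriv_x[OF smooth_strip_iter_d_x[OF assms(1)] assms(2)] by blast

lemma schwartz_strip_slice:
  assumes "h \<in> schwartz_strip T" "t \<in> {0..T}"
  shows "h t \<in> schwartz"
proof -
  have "(SUP x. ennreal \<bar>(1 + \<bar>x\<bar>\<^sup>2) ^ k * (deriv ^^ i) (h t) x\<bar>) < \<infinity>" for k i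
  proof -
    obtain C where C: "\<And>t x. t \<in> {0..T} \<Longrightarrow> (1 + x\<^sup>2) ^ k * \<bar>(d_x ^^ i) ((d_t T ^^ 0) h) t x\<bar> \<le> C"
      using schwartz_strip_bound[OF assms(1)] by blast
    have "(SUP x. ennreal \<bar>(1 + \<bar>x\<bar>\<^sup>2) ^ k * (deriv ^^ i) (h t) x\<bar>) \<le> ennreal C"
      using C[OF assms(2)] by (intro SUP_least ennreal_leI) (simp add: iter_d_x_slice abs_mult)
    then show ?thesis unfolding infinity_ennreal_def by (rule le_less_trans) (rule ennreal_less_top)
  qed
  moreover have "smooth_real (h t)"
    using assms smooth_strip_slice by (auto simp: schwartz_strip_def)
  ultimately show ?thesis by (auto simp: schwartz_def schwartz_seminorm_def)
qed

lemma schwartz_bounded: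
  assumes "f \<in> schwartz"
  obtains C where "\<And>x. \<bar>f x\<bar> \<le> C"
proof -
  define s where "s = schwartz_seminorm 0 0 f"
  have s: "s < \<infinity>" using assms by (auto simp: s_def schwartz_def)
  have "\<bar>f x\<bar> \<le> enn2real s" for x
  proof -
    have "ennreal \<bar>f x\<bar> \<le> s" unfolding s_def schwartz_seminorm_def by (auto intro: SUP_upper2[of x])
    then show ?thesis
      using s by (metis abs_ge_zero enn2real_ennreal enn2real_mono infinity_ennreal_def)
  qed
  then show ?thesis by (rule that)
qed

text \<open>A positive derivative gives injectivity; boundedness of f gives surjectivity, since g
  takes values on both sides of y at y - C and y + C.\<close>

lemma Diff_S_I:
  assumes f: "f \<in> schwartz" and g: "g = (\<lambda>x. x + f x)" and sm: "smooth_real g"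
    and pos: "\<And>x. 0 < deriv g x"
  shows "g \<in> Diff_S"
proof -
  obtain C where C: "\<And>x. \<bar>f x\<bar> \<le> C" using schwartz_bounded[OF f] by blast
  have inc: "g x < g y" if "x < y" for x y
    using DERIV_pos_imp_increasing[OF that, of g] smooth_real_has_deriv[OF sm] pos by blast
  have "inj g" by (rule linorder_injI) (use inc less_imp_neq in blast)
  moreover have "surj g"
  proof -
    have "\<exists>x. g x = y" for y
    proof -
      have "g (y - C) \<le> y" "y \<le> g (y + C)" "y - C \<le> y + C"
        using C[of "y - C"] C[of "y + C"] by (auto simp: g abs_le_iff)
      moreover have "continuous_on {y - C..y + C} g"
        using smooth_real_continuous[OF sm] continuous_on_subset by blast
      ultimately show ?thesis using IVT'[of g "y - C" y "y + C"] by blast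
    qed
    then show ?thesis by (metis surjI)
  qed
  ultimately have "bij g" by (simp add: bij_def)
  then show ?thesis
    using smooth_real_inv[OF sm _ pos] sm f g by (auto simp: Diff_S_def diffeomorphism_def)
qed

text \<open>Differentiating \<open>inv g\<close> after g shows that g' never vanishes. As g stays at
  bounded distance from the identity, g' is positive somewhere, hence everywhere by
  continuity.\<close>

lemma Diff_S_deriv_pos:
  assumes "g \<in> Diff_S"
  shows "0 < deriv g x"
proof (rule ccontr)
  assume neg: "\<not> 0 < deriv g x"
  from assms obtain f where f: "f \<in> schwartz" and g: "g = (\<lambda>x. x + f x)"
    and bij: "bij g" and sm: "smooth_real g" and smi: "smooth_real (inv g)"
    by (auto simp: Diff_S_def diffeomorphism_def)
  have nz: "deriv g y \<noteq> 0" for y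
  proof -
    have "((\<lambda>z. inv g (g z)) has_field_derivative deriv (inv g) (g y) * deriv g y) (at y)"
      by (rule DERIV_chain2[OF smooth_real_has_deriv[OF smi] smooth_real_has_deriv[OF sm]])
    then have "((\<lambda>z. z) has_field_derivative deriv (inv g) (g y) * deriv g y) (at y)"
      using bij by (simp add: bij_is_inj)
    then have "deriv (inv g) (g y) * deriv g y = 1" using DERIV_ident DERIV_unique by blast
    then show ?thesis by auto
  qed
  obtain C where C: "\<And>x. \<bar>f x\<bar> \<le> C" using schwartz_bounded[OF f] by blast
  have "0 \<le> C" using C[of 0] by linarith
  \<comment> \<open>The length 2 C + 1 exceeds 2 C, the most by which f can drop, so g increases
    over this interval.\<close>
  then obtain z where z: "g (2 * C + 1) - g 0 = (2 * C + 1 - 0) * deriv g z"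
    using MVT2[of 0 "2 * C + 1" g "deriv g"] smooth_real_has_deriv[OF sm] by auto
  have "0 < g (2 * C + 1) - g 0"
    using C[of "2 * C + 1"] C[of 0] unfolding g by linarith
  then have "0 < deriv g z" using z \<open>0 \<le> C\<close> by (simp add: zero_less_mult_iff)
  moreover have "continuous_on UNIV (deriv g)"
    using sm smooth_real_continuous smooth_real_deriv by blast
  then have "connected (range (deriv g))" by (rule connected_continuous_image) simp
  ultimately have "0 \<in> range (deriv g)"
    using neg connectedD_interval[of "range (deriv g)" "deriv g x" "deriv g z" 0] by auto
  then show False using nz by auto
qed

subsection \<open>Integration over the strip\<close>

text \<open>Two classes are needed because \<open>d_x \<phi>\<close> tends to 1 at infinity and is
  merely bounded, whereas the velocity decays.\<close>

definition strip_bounded :: "real \<Rightarrow> (real \<Rightarrow> real \<Rightarrow> real) \<Rightarrow> bool" where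
  "strip_bounded T f \<longleftrightarrow> continuous_on ({0..T} \<times> UNIV) (\<lambda>(t, x). f t x) \<and>
     (\<exists>C. \<forall>t\<in>{0..T}. \<forall>x. \<bar>f t x\<bar> \<le> C)"

text \<open>An integrable majorant that is uniform in time; this rate is what the seminorm weight k
  = 1 provides.\<close>

definition strip_decay :: "real \<Rightarrow> (real \<Rightarrow> real \<Rightarrow> real) \<Rightarrow> bool" where
  "strip_decay T f \<longleftrightarrow> continuous_on ({0..T} \<times> UNIV) (\<lambda>(t, x). f t x) \<and>
     (\<exists>C. \<forall>t\<in>{0..T}. \<forall>x. \<bar>f t x\<bar> \<le> C * inverse (1 + x\<^sup>2))"

definition strip_integral :: "real \<Rightarrow> (real \<Rightarrow> real \<Rightarrow> real) \<Rightarrow> real" where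
  "strip_integral T f = (LBINT t:{0..T}. (LBINT x. f t x))"

lemma strip_decay_imp_bounded:
  assumes "strip_decay T f"
  shows "strip_bounded T f"
proof -
  obtain C where C: "\<And>t x. t \<in> {0..T} \<Longrightarrow> \<bar>f t x\<bar> \<le> C * inverse (1 + x\<^sup>2)"
    using assms unfolding strip_decay_def by blast
  have "\<bar>f t x\<bar> \<le> \<bar>C\<bar>" if "t \<in> {0..T}" for t x
  proof -
    have "\<bar>f t x\<bar> \<le> \<bar>C\<bar> * inverse (1 + x\<^sup>2)"
      by (rule order_trans[OF C[OF that]]) (auto intro!: mult_right_mono)
    also have "\<dots> \<le> \<bar>C\<bar> * 1"
      by (intro mult_left_mono) (auto simp: inverse_le_1_iff)
    finally show ?thesis by simp
  qed
  then show ?thesis using assms unfolding strip_bounded_def strip_decay_def by blast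
qed

lemma strip_decay_mult:
  assumes f: "strip_decay T f" and g: "strip_bounded T g"
  shows "strip_decay T (\<lambda>t x. f t x * g t x)"
proof -
  obtain C where C: "\<And>t x. t \<in> {0..T} \<Longrightarrow> \<bar>f t x\<bar> \<le> C * inverse (1 + x\<^sup>2)"
    using f unfolding strip_decay_def by blast
  obtain D where D: "\<And>t x. t \<in> {0..T} \<Longrightarrow> \<bar>g t x\<bar> \<le> D"
    using g unfolding strip_bounded_def by blast
  have "\<bar>f t x * g t x\<bar> \<le> (C * D) * inverse (1 + x\<^sup>2)" if "t \<in> {0..T}" for t x
    using mult_mono[OF C[OF that] D[OF that]] C[OF that, of x] order_trans[OF abs_ge_zero]
    by (fastforce simp: abs_mult mult_ac)
  moreover have "continuous_on ({0..T} \<times> UNIV) (\<lambda>(t, x). f t x * g t x)"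
    using f g by (auto simp: strip_bounded_def strip_decay_def split_beta intro!: continuous_intros)
  ultimately show ?thesis unfolding strip_decay_def by blast
qed

lemma strip_bounded_const: "strip_bounded T (\<lambda>t x. c)"
  by (auto simp: strip_bounded_def)

lemma strip_decay_add_cmult:
  assumes f: "strip_decay T f" and g: "strip_decay T g"
  shows "strip_decay T (\<lambda>t x. f t x + c * g t x)"
proof -
  obtain C where C: "\<And>t x. t \<in> {0..T} \<Longrightarrow> \<bar>f t x\<bar> \<le> C * inverse (1 + x\<^sup>2)"
    using f unfolding strip_decay_def by blast
  obtain D where D: "\<And>t x. t \<in> {0..T} \<Longrightarrow> \<bar>g t x\<bar> \<le> D * inverse (1 + x\<^sup>2)"
    using g unfolding strip_decay_def by blast
  have "\<bar>f t x + c * g t x\<bar> \<le> (C + \<bar>c\<bar> * D) * inverse (1 + x\<^sup>2)" if "t \<in> {0..T}" for t x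
  proof -
    have "\<bar>f t x + c * g t x\<bar> \<le> \<bar>f t x\<bar> + \<bar>c\<bar> * \<bar>g t x\<bar>"
      using abs_triangle_ineq[of "f t x" "c * g t x"] by (simp add: abs_mult)
    also have "\<dots> \<le> C * inverse (1 + x\<^sup>2) + \<bar>c\<bar> * (D * inverse (1 + x\<^sup>2))"
      using C[OF that] D[OF that] by (intro add_mono mult_left_mono) auto
    finally show ?thesis by (simp add: algebra_simps)
  qed
  moreover have "continuous_on ({0..T} \<times> UNIV) (\<lambda>(t, x). f t x + c * g t x)"
    using f g by (auto simp: strip_decay_def split_beta intro!: continuous_intros)
  ultimately show ?thesis unfolding strip_decay_def by blast
qed

lemma lborel_integrable_inverse_1_plus_square: "integrable lborel (\<lambda>x::real. inverse (1 + x\<^sup>2))"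
  using integrable_inverse_1_plus_square by (simp add: set_integrable_def)

lemma strip_decay_integrable_slice:
  assumes f: "strip_decay T f" and t: "t \<in> {0..T}"
  shows "integrable lborel (f t)"
proof -
  obtain C where C: "\<And>t x. t \<in> {0..T} \<Longrightarrow> \<bar>f t x\<bar> \<le> C * inverse (1 + x\<^sup>2)"
    using f unfolding strip_decay_def by blast
  have "continuous_on UNIV (\<lambda>x. (\<lambda>(t, x). f t x) (t, x))"
    by (rule continuous_on_compose2[of "{0..T} \<times> UNIV"])
       (use f t in \<open>auto simp: strip_decay_def intro!: continuous_intros\<close>)
  then have "f t \<in> borel_measurable lborel" by (simp add: borel_measurable_continuous_onI)
  then show ?thesis
    by (rule Bochner_Integration.integrable_bound
          [OF integrable_mult_right[OF lborel_integrable_inverse_1_plus_square, of C]])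
       (auto intro!: AE_I2 order_trans[OF C[OF t] abs_ge_self] simp del: abs_mult)
qed

lemma strip_decay_set_integrable:
  assumes f: "strip_decay T f"
  shows "set_integrable lborel {0..T} (\<lambda>t. LBINT x. f t x)"
proof -
  obtain C where C: "\<And>t x. t \<in> {0..T} \<Longrightarrow> \<bar>f t x\<bar> \<le> C * inverse (1 + x\<^sup>2)"
    using f unfolding strip_decay_def by blast
  \<comment> \<open>Nothing is known about f at times outside [0,T], so f is set to 0 there.
    Continuity on the closed strip then makes the function Borel on the plane, which yields
    measurability of the inner integral in t.\<close>
  define F where "F = (\<lambda>(t, x). indicator {0..T} t *\<^sub>R f t x)"
  have "(\<lambda>p. indicator ({0..T} \<times> UNIV) p *\<^sub>R (\<lambda>(t, x). f t x) p) \<in> borel_measurable borel"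
    by (rule borel_measurable_continuous_on_indicator)
       (use f in \<open>auto simp: strip_decay_def intro!: borel_closed closed_Times\<close>)
  also have "(\<lambda>p. indicator ({0..T} \<times> UNIV) p *\<^sub>R (\<lambda>(t, x). f t x) p) = F"
    by (auto simp: F_def indicator_def)
  finally have "F \<in> borel_measurable (lborel \<Otimes>\<^sub>M lborel)" by (simp add: lborel_prod)
  then have "(\<lambda>t. LBINT x. F (t, x)) \<in> borel_measurable lborel"
    by (intro lborel.borel_measurable_lebesgue_integral) (simp add: F_def split_beta)
  then have meas: "(\<lambda>t. indicator {0..T} t *\<^sub>R (LBINT x. f t x)) \<in> borel_measurable lborel"
    by (simp add: F_def)
  define D where "D = (LBINT x. C * inverse (1 + x\<^sup>2))"
  have bound: "\<bar>LBINT x. f t x\<bar> \<le> D" if "t \<in> {0..T}" for t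
  proof -
    have "\<bar>LBINT x. f t x\<bar> \<le> (LBINT x. \<bar>f t x\<bar>)" by (rule integral_abs_bound)
    also have "\<dots> \<le> D"
      unfolding D_def
      by (rule integral_mono)
         (use C[OF that] strip_decay_integrable_slice[OF f that] lborel_integrable_inverse_1_plus_square in auto)
    finally show ?thesis .
  qed
  have "integrable lborel (\<lambda>t. indicator {0..T} t *\<^sub>R D)"
    by (intro integrable_scaleR_left integrable_real_indicator) (auto simp: emeasure_lborel_Icc_eq)
  then show ?thesis
    unfolding set_integrable_def
    by (rule Bochner_Integration.integrable_bound[OF _ meas])
       (auto simp: indicator_def intro!: AE_I2 order_trans[OF bound abs_ge_self])
qed

lemma strip_integral_add_cmult:
  assumes f: "strip_decay T f" and g: "strip_decay T g"
  shows "strip_integral T (\<lambda>t x. f t x + c * g t x) = strip_integral T f + c * strip_integral T g"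
proof -
  have "strip_integral T (\<lambda>t x. f t x + c * g t x) = (LBINT t:{0..T}. (LBINT x. f t x) + c * (LBINT x. g t x))"
    unfolding strip_integral_def
    by (rule set_lebesgue_integral_cong)
       (auto simp: strip_decay_integrable_slice[OF f] strip_decay_integrable_slice[OF g])
  also have "\<dots> = strip_integral T f + c * strip_integral T g"
    unfolding strip_integral_def
    using strip_decay_set_integrable[OF f] strip_decay_set_integrable[OF g]
    by (subst set_integral_add(2)) auto
  finally show ?thesis .
qed

lemma strip_integral_mono:
  assumes f: "strip_decay T f" and g: "strip_decay T g"
    and le: "\<And>t x. t \<in> {0..T} \<Longrightarrow> f t x \<le> g t x"
  shows "strip_integral T f \<le> strip_integral T g"
  unfolding strip_integral_def
  by (intro set_integral_mono strip_decay_set_integrable f g integral_mono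
        strip_decay_integrable_slice[OF f] strip_decay_integrable_slice[OF g] le)

text \<open>Every term of (u + e a)^2 (v + e b) contains two decaying factors and one bounded
  factor, so each coefficient is integrable. \<open>I1\<close> and \<open>I3\<close> stay anonymous,
  since only the quadratic coefficient will have a known sign.\<close>

lemma strip_integral_energy_expand:
  assumes u: "strip_decay T u" and a: "strip_decay T a" and v: "strip_bounded T v" and b: "strip_bounded T b"
  obtains I1 I3 where
    "\<And>e. strip_integral T (\<lambda>t x. (u t x + e * a t x)\<^sup>2 * (v t x + e * b t x)) =
      strip_integral T (\<lambda>t x. (u t x)\<^sup>2 * v t x) + e * I1
      + e\<^sup>2 * strip_integral T (\<lambda>t x. a t x * (a t x * v t x) + 2 * (u t x * (a t x * b t x)))
      + e ^ 3 * I3"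
proof -
  have u': "strip_bounded T u" and a': "strip_bounded T a" using u a strip_decay_imp_bounded by auto
  have av: "strip_decay T (\<lambda>t x. a t x * v t x)" and ab: "strip_decay T (\<lambda>t x. a t x * b t x)"
    and ub: "strip_decay T (\<lambda>t x. u t x * b t x)" and uv: "strip_decay T (\<lambda>t x. u t x * v t x)"
    using strip_decay_mult a u v b by auto
  define F0 where "F0 = (\<lambda>t x. u t x * (u t x * v t x))"
  define F1 where "F1 = (\<lambda>t x. u t x * (u t x * b t x) + 2 * (u t x * (a t x * v t x)))"
  define F2 where "F2 = (\<lambda>t x. a t x * (a t x * v t x) + 2 * (u t x * (a t x * b t x)))"
  define F3 where "F3 = (\<lambda>t x. a t x * (a t x * b t x))"
  have F: "strip_decay T F0" "strip_decay T F1" "strip_decay T F2" "strip_decay T F3"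
    unfolding F0_def F1_def F2_def F3_def
    by (intro strip_decay_add_cmult strip_decay_mult u a strip_decay_imp_bounded av ab ub uv)+
  have "strip_integral T (\<lambda>t x. (u t x + e * a t x)\<^sup>2 * (v t x + e * b t x)) =
      strip_integral T F0 + e * strip_integral T F1 + e\<^sup>2 * strip_integral T F2 + e ^ 3 * strip_integral T F3"
    for e
  proof -
    \<comment> \<open>Horner form in e, so that linearity of the integral can be applied one level
      at a time.\<close>
    have "(\<lambda>t x. (u t x + e * a t x)\<^sup>2 * (v t x + e * b t x)) =
        (\<lambda>t x. F0 t x + e * (F1 t x + e * (F2 t x + e * F3 t x)))"
      by (intro ext) (simp add: F0_def F1_def F2_def F3_def power2_eq_square algebra_simps)
    then show ?thesis
      by (simp add: strip_integral_add_cmult strip_decay_add_cmult F)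
         (simp add: power2_eq_square power3_eq_cube algebra_simps)
  qed
  moreover have "F0 = (\<lambda>t x. (u t x)\<^sup>2 * v t x)"
    by (intro ext) (simp add: F0_def power2_eq_square)
  ultimately show ?thesis using that unfolding F2_def by simp
qed

subsection \<open>A direction of negative second variation\<close>

text \<open>By continuity f exceeds f(s)/2 on an interval around s, which fits into S because s is
  an interior point.\<close>

lemma set_integral_pos:
  fixes f :: "real \<Rightarrow> real"
  assumes S: "set_integrable lborel S f" and cont: "continuous_on UNIV f"
    and nonneg: "\<And>x. 0 \<le> f x" and s: "s \<in> interior S" and pos: "0 < f s"
  shows "0 < (LBINT x:S. f x)"
proof -
  obtain d where d: "0 < d" "\<And>y. dist y s < d \<Longrightarrow> dist (f y) (f s) < f s / 2"
    using cont pos unfolding continuous_on_iff by (metis UNIV_I half_gt_zero)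
  obtain r where r: "0 < r" "ball s r \<subseteq> S" using s by (auto simp: mem_interior)
  define e where "e = min d r / 2"
  have e: "0 < e" "e < d" "e < r" using d(1) r(1) by (auto simp: e_def)
  have low: "indicator {s - e..s + e} x * (f s / 2) \<le> indicator S x * f x" for x
  proof (cases "x \<in> {s - e..s + e}")
    case True
    then have "\<bar>x - s\<bar> \<le> e" by auto
    then have "\<bar>f x - f s\<bar> < f s / 2" using d(2)[of x] e by (auto simp: dist_real_def)
    moreover have "x \<in> S" using r(2) \<open>\<bar>x - s\<bar> \<le> e\<close> e by (auto simp: subset_eq dist_real_def)
    ultimately show ?thesis using True pos by (auto simp: abs_if split: if_splits)
  qed (use nonneg in \<open>auto simp: indicator_def\<close>)
  have int: "integrable lborel (\<lambda>x. indicator {s - e..s + e} x * (f s / 2))"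
    by (intro integrable_mult_left integrable_real_indicator) (auto simp: emeasure_lborel_Icc_eq)
  have "0 < 2 * e * (f s / 2)" using e pos by simp
  also have "\<dots> = (LBINT x. indicator {s - e..s + e} x * (f s / 2))"
    using e by simp
  also have "\<dots> \<le> (LBINT x:S. f x)"
    unfolding set_lebesgue_integral_def real_scaleR_def
    by (rule integral_mono[OF int _ low]) (use S in \<open>simp add: set_integrable_def\<close>)
  finally show ?thesis .
qed

lemma integrable_compact_support:
  fixes f :: "real \<Rightarrow> real"
  assumes "continuous_on UNIV f" and "\<And>x. r \<le> \<bar>x\<bar> \<Longrightarrow> f x = 0"
  shows "integrable lborel f"
proof -
  have "set_integrable lborel {-r..r} f"
    by (rule borel_integrable_atLeastAtMost') (rule continuous_on_subset[OF assms(1)], simp)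
  moreover have "(\<lambda>x. indicator {-r..r} x *\<^sub>R f x) = f"
  proof
    show "indicator {-r..r} x *\<^sub>R f x = f x" for x
      using assms(2)[of x] by (cases "x \<in> {-r..r}") auto
  qed
  ultimately show ?thesis by (simp add: set_integrable_def)
qed

text \<open>\<open>P\<close> and \<open>S\<close> are the coefficients in (\<tau>, \<xi>) = P
  (\<mu>, 1) + S (1, 0). At (\<mu>, 1) the form is at most -\<kappa>: the term 2 u \<mu> is at most
  -m c^2, and m (3 w) <= 1 keeps v \<mu>^2 below half of m c^2. The cross term consumes half of
  \<kappa>; what remains goes into \<open>K\<close>.\<close>

lemma quadratic_form_bound:
  fixes u v c w \<mu> m P S :: real
  assumes c: "c \<noteq> 0" and u: "\<bar>u - c\<bar> \<le> \<bar>c\<bar> / 2" and v: "\<bar>v - w\<bar> \<le> w / 2" and w: "0 < w"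
    and m: "0 < m" "m * (3 * w) \<le> 1" "m * \<bar>c\<bar> \<le> 1" and \<mu>: "\<mu> = - (m * c)"
    and \<kappa>: "\<kappa> = m * c\<^sup>2 / 2" and K: "K = (3 * w + 3 * \<bar>c\<bar>)\<^sup>2 / (2 * \<kappa>) + 2 * w"
  shows "v * (\<mu> * P + S)\<^sup>2 + 2 * u * (\<mu> * P + S) * P \<le> - (\<kappa> / 2) * P\<^sup>2 + K * S\<^sup>2"
proof -
  define L where "L = 3 * w + 3 * \<bar>c\<bar>"
  have kpos: "0 < \<kappa>" using m c by (simp add: \<kappa>)
  have uc: "c\<^sup>2 / 2 \<le> u * c"
  proof -
    have "\<bar>(u - c) * c\<bar> \<le> \<bar>c\<bar> / 2 * \<bar>c\<bar>"
      unfolding abs_mult by (rule mult_right_mono[OF u]) simp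
    then have "- (c\<^sup>2 / 2) \<le> (u - c) * c" by (auto simp: power2_eq_square abs_le_iff)
    then show ?thesis by (simp add: power2_eq_square algebra_simps)
  qed
  have v2: "0 \<le> v" "v \<le> 3 * w / 2" using v w by linarith+
  have "v * \<mu>\<^sup>2 + 2 * u * \<mu> = m * ((v * m) * c\<^sup>2 - 2 * (u * c))"
    by (simp add: \<mu> power2_eq_square algebra_simps)
  also have "\<dots> \<le> m * (1 / 2 * c\<^sup>2 - 2 * (c\<^sup>2 / 2))"
  proof (intro mult_left_mono diff_mono mult_right_mono)
    have "v * m \<le> 3 * w / 2 * m" using v2 m by (intro mult_right_mono) auto
    then show "v * m \<le> 1 / 2" using m(2) by (simp add: mult.commute)
  qed (use uc m in auto)
  also have "\<dots> = - \<kappa>" by (simp add: \<kappa>)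
  finally have lead: "v * \<mu>\<^sup>2 + 2 * u * \<mu> \<le> - \<kappa>" .
  have cross: "\<bar>2 * v * \<mu> + 2 * u\<bar> \<le> L"
  proof -
    have "\<bar>\<mu>\<bar> \<le> 1" using m by (simp add: \<mu> abs_mult)
    then have "\<bar>v * \<mu>\<bar> \<le> 3 * w / 2 * 1" using v2 unfolding abs_mult by (intro mult_mono) auto
    moreover have "\<bar>u\<bar> \<le> 3 * \<bar>c\<bar> / 2" using u by linarith
    ultimately show ?thesis unfolding L_def by linarith
  qed
  \<comment> \<open>Weighted so that, after division by 2 \<kappa>, the square of P gets the
    coefficient \<kappa>/2.\<close>
  have "2 * (\<kappa> * \<bar>P\<bar>) * (L * \<bar>S\<bar>) \<le> (\<kappa> * \<bar>P\<bar>)\<^sup>2 + (L * \<bar>S\<bar>)\<^sup>2"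
    by (rule sum_squares_bound)
  then have "L * (\<bar>P\<bar> * \<bar>S\<bar>) \<le> \<kappa> / 2 * P\<^sup>2 + L\<^sup>2 / (2 * \<kappa>) * S\<^sup>2"
    using kpos by (simp add: field_simps power2_eq_square)
  moreover have "(2 * v * \<mu> + 2 * u) * (P * S) \<le> L * (\<bar>P\<bar> * \<bar>S\<bar>)"
  proof -
    have "(2 * v * \<mu> + 2 * u) * (P * S) \<le> \<bar>2 * v * \<mu> + 2 * u\<bar> * (\<bar>P\<bar> * \<bar>S\<bar>)"
      using abs_ge_self[of "(2 * v * \<mu> + 2 * u) * (P * S)"] by (simp add: abs_mult)
    also have "\<dots> \<le> L * (\<bar>P\<bar> * \<bar>S\<bar>)" by (rule mult_right_mono[OF cross]) simp
    finally show ?thesis .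
  qed
  moreover have "(v * \<mu>\<^sup>2 + 2 * u * \<mu>) * P\<^sup>2 \<le> - \<kappa> * P\<^sup>2" by (rule mult_right_mono[OF lead]) simp
  moreover have "v * S\<^sup>2 \<le> 2 * w * S\<^sup>2" using v2 w by (intro mult_right_mono) auto
  moreover have "v * (\<mu> * P + S)\<^sup>2 + 2 * u * (\<mu> * P + S) * P =
      (v * \<mu>\<^sup>2 + 2 * u * \<mu>) * P\<^sup>2 + (2 * v * \<mu> + 2 * u) * (P * S) + v * S\<^sup>2"
    by (simp add: power2_eq_square algebra_simps)
  ultimately show ?thesis unfolding K L_def[symmetric] by (simp add: algebra_simps)
qed

text \<open>The form \<open>v \<tau>\<^sup>2 + 2 u \<tau> \<xi>\<close> is indefinite where \<open>u \<noteq> 0\<close>. A bump that is thin (width \<open>\<delta>\<close>)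
  across the lines of slope \<open>-\<mu>\<close> has its gradient almost in the negative direction \<open>(\<mu>, 1)\<close>,
  and the remaining terms are smaller by a factor \<open>\<delta>\<^sup>2\<close>.\<close>
lemma negative_direction_exists:
  assumes T: "0 < T" and t0: "0 < t0" "t0 < T"
    and ub: "strip_bounded T u" and vb: "strip_bounded T v"
    and u0: "u t0 x0 \<noteq> 0" and v0: "0 < v t0 x0"
  obtains \<eta> where "\<eta> \<in> schwartz_strip T" "\<And>x. \<eta> 0 x = 0" "\<And>x. \<eta> T x = 0"
    "\<And>t x. t \<in> {0..T} \<Longrightarrow> d_x \<eta> t x \<noteq> 0 \<Longrightarrow> v t0 x0 / 2 \<le> v t x"
    "strip_integral T (\<lambda>t x. d_t T \<eta> t x * (d_t T \<eta> t x * v t x)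
       + 2 * (u t x * (d_t T \<eta> t x * d_x \<eta> t x))) < 0"
proof -
  define c where "c = u t0 x0"
  define w where "w = v t0 x0"
  have c: "c \<noteq> 0" and w: "0 < w" using u0 v0 by (auto simp: c_def w_def)
  have st0: "(t0, x0) \<in> {0..T} \<times> UNIV" using t0 by auto
  obtain d1 where d1: "0 < d1"
    "\<And>t x. t \<in> {0..T} \<Longrightarrow> dist (t, x) (t0, x0) < d1 \<Longrightarrow> \<bar>u t x - c\<bar> < \<bar>c\<bar> / 2"
  proof -
    have "0 < \<bar>c\<bar> / 2" using c by simp
    with ub st0 obtain d where "0 < d" "\<forall>p\<in>{0..T} \<times> UNIV. dist p (t0, x0) < d \<longrightarrow>
        dist ((\<lambda>(t, x). u t x) p) ((\<lambda>(t, x). u t x) (t0, x0)) < \<bar>c\<bar> / 2"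
      unfolding strip_bounded_def continuous_on_iff by blast
    then show ?thesis using that[of d] by (auto simp: c_def dist_real_def)
  qed
  obtain d2 where d2: "0 < d2"
    "\<And>t x. t \<in> {0..T} \<Longrightarrow> dist (t, x) (t0, x0) < d2 \<Longrightarrow> \<bar>v t x - w\<bar> < w / 2"
  proof -
    have "0 < w / 2" using w by simp
    with vb st0 obtain d where "0 < d" "\<forall>p\<in>{0..T} \<times> UNIV. dist p (t0, x0) < d \<longrightarrow>
        dist ((\<lambda>(t, x). v t x) p) ((\<lambda>(t, x). v t x) (t0, x0)) < w / 2"
      unfolding strip_bounded_def continuous_on_iff by blast
    then show ?thesis using that[of d] by (auto simp: w_def dist_real_def)
  qed
  \<comment> \<open>The box of radius \<rho> lies in both neighbourhoods, since the distance is at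
    most the sum of the coordinate distances, and its times stay between 0 and T.\<close>
  define \<rho> where "\<rho> = min (min (d1 / 2) (d2 / 2)) (min t0 (T - t0))"
  have \<rho>: "0 < \<rho>" "\<rho> \<le> t0" "\<rho> \<le> T - t0" "2 * \<rho> \<le> d1" "2 * \<rho> \<le> d2"
    using d1(1) d2(1) t0 by (auto simp: \<rho>_def min_def)
  have near: "\<bar>u t x - c\<bar> \<le> \<bar>c\<bar> / 2" "\<bar>v t x - w\<bar> \<le> w / 2"
    if "t \<in> {0..T}" "\<bar>t - t0\<bar> < \<rho>" "\<bar>x - x0\<bar> < \<rho>" for t x
  proof -
    have "dist (t, x) (t0, x0) \<le> \<bar>t - t0\<bar> + \<bar>x - x0\<bar>"
      unfolding dist_prod_def by (rule order_trans[OF sqrt_sum_squares_le_sum_abs]) (simp add: dist_real_def)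
    then have "dist (t, x) (t0, x0) < d1" "dist (t, x) (t0, x0) < d2" using that \<rho> by linarith+
    then show "\<bar>u t x - c\<bar> \<le> \<bar>c\<bar> / 2" "\<bar>v t x - w\<bar> \<le> w / 2"
      using d1(2)[OF that(1)] d2(2)[OF that(1)] less_imp_le by blast+
  qed
  define m where "m = min (1 / (3 * w)) (1 / \<bar>c\<bar>)"
  have m: "0 < m" "m * (3 * w) \<le> 1" "m * \<bar>c\<bar> \<le> 1"
    using c w by (auto simp: m_def min_def field_simps)
  define \<mu> where "\<mu> = - (m * c)"
  have \<mu>1: "\<bar>\<mu>\<bar> \<le> 1" using m by (simp add: \<mu>_def abs_mult)
  define \<kappa> where "\<kappa> = m * c\<^sup>2 / 2"
  have kpos: "0 < \<kappa>" using m c by (simp add: \<kappa>_def)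
  define K where "K = (3 * w + 3 * \<bar>c\<bar>)\<^sup>2 / (2 * \<kappa>) + 2 * w"
  have Kpos: "0 < K" using kpos w by (simp add: K_def add_nonneg_pos)

  \<comment> \<open>\<open>p\<close> is the profile across the thin strip, to be rescaled to width
    \<delta>; \<open>q\<close> cuts off in time. Its radius \<rho>/2 leaves room for the horizontal
    drift of the slanted strip.\<close>
  obtain p where p: "smooth_real p" "\<And>x. 1 \<le> \<bar>x\<bar> \<Longrightarrow> p x = 0" "p 0 \<noteq> 0"
    using smooth_bump_exists[of 1] by auto
  obtain q where q: "smooth_real q" "\<And>x. \<rho> / 2 \<le> \<bar>x\<bar> \<Longrightarrow> q x = 0" "q 0 \<noteq> 0"
    using smooth_bump_exists[of "\<rho> / 2"] \<rho> by auto
  have p': "deriv p x = 0" if "1 \<le> \<bar>x\<bar>" for x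
    by (rule smooth_real_deriv_eq_0[OF p(1,2) that])
  have q': "deriv q x = 0" if "\<rho> / 2 \<le> \<bar>x\<bar>" for x
    by (rule smooth_real_deriv_eq_0[OF q(1,2) that])
  note contp = smooth_real_continuous[OF p(1)] smooth_real_continuous[OF smooth_real_deriv[OF p(1)]]
  note contq = smooth_real_continuous[OF q(1)] smooth_real_continuous[OF smooth_real_deriv[OF q(1)]]
  define A where "A = (LBINT x. (deriv p x)\<^sup>2)"
  define B where "B = (LBINT x. (p x)\<^sup>2)"
  define A2 where "A2 = (LBINT t:{0..T}. (q (t - t0))\<^sup>2)"
  define B2 where "B2 = (LBINT t:{0..T}. (deriv q (t - t0))\<^sup>2)"
  have A: "0 < A"
  proof -
    \<comment> \<open>Otherwise p would be constant, although it is nonzero at 0 and zero at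
      1.\<close>
    obtain s where s: "deriv p s \<noteq> 0"
    proof (rule ccontr)
      assume "\<not> thesis"
      then have "\<forall>x. (p has_real_derivative 0) (at x)"
        using that smooth_real_has_deriv[OF p(1)] by metis
      then have "p 0 = p 1" by (rule DERIV_isconst_all)
      then show False using p(2)[of 1] p(3) by simp
    qed
    have "integrable lborel (\<lambda>x. (deriv p x)\<^sup>2)"
      by (rule integrable_compact_support[of _ 1]) (use contp p' in \<open>auto intro!: continuous_intros\<close>)
    then have "0 < (LBINT x:UNIV. (deriv p x)\<^sup>2)"
      by (intro set_integral_pos[where s = s])
         (use contp s in \<open>auto intro!: continuous_intros simp: set_integrable_def\<close>)
    then show ?thesis by (simp add: A_def set_lebesgue_integral_def)
  qed
  have B: "0 \<le> B" unfolding B_def by (intro Bochner_Integration.integral_nonneg) simp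
  have contq_t: "continuous_on UNIV (\<lambda>t. (q (t - t0))\<^sup>2)" "continuous_on UNIV (\<lambda>t. (deriv q (t - t0))\<^sup>2)"
    using contq by (auto intro!: continuous_intros elim!: continuous_on_compose2)
  have intq: "set_integrable lborel {0..T} (\<lambda>t. (q (t - t0))\<^sup>2)"
    "set_integrable lborel {0..T} (\<lambda>t. (deriv q (t - t0))\<^sup>2)"
    by (intro borel_integrable_atLeastAtMost' continuous_on_subset[OF contq_t(1)]
        continuous_on_subset[OF contq_t(2)] subset_UNIV)+
  have A2: "0 < A2"
    unfolding A2_def by (rule set_integral_pos[OF intq(1) contq_t(1), where s = t0]) (use q t0 in auto)
  have B2: "0 \<le> B2"
    unfolding B2_def set_lebesgue_integral_def by (intro Bochner_Integration.integral_nonneg) simp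
  \<comment> \<open>The quadratic coefficient will turn out to be at most (\<delta>^2 K B B2 - M) /
    \<delta>. With \<delta>^2 <= \<delta> <= M / (2 N) this is negative; the summand 1 in
    \<open>N\<close> is there because B and B2 are only known to be nonnegative.\<close>
  define M where "M = \<kappa> / 2 * A * A2"
  define N where "N = K * B * B2 + 1"
  have M: "0 < M" and N: "0 < N"
    using kpos A A2 Kpos B B2 by (auto simp: M_def N_def intro!: add_nonneg_pos)
  define \<delta> where "\<delta> = min (\<rho> / 2) (min 1 (M / (2 * N)))"
  have \<delta>: "0 < \<delta>" "\<delta> \<le> \<rho> / 2" "\<delta> \<le> 1" "\<delta> \<le> M / (2 * N)" using \<rho> M N by (auto simp: \<delta>_def)
  have small: "\<delta>\<^sup>2 * (K * B * B2) < M"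
  proof -
    have "\<delta>\<^sup>2 \<le> \<delta>" using \<delta> by (simp add: power2_eq_square mult_left_le)
    then have "\<delta>\<^sup>2 * (K * B * B2) \<le> \<delta> * N"
      using \<delta> Kpos B B2 by (intro mult_mono) (auto simp: N_def)
    also have "\<dots> \<le> M / 2" using \<delta>(4) N by (simp add: field_simps)
    also have "\<dots> < M" using M by simp
    finally show ?thesis .
  qed

  \<comment> \<open>Expanded into the form a + b t + c x required by
    \<open>Ck_strip_compose_affine\<close>. The gradient of z is (\<mu>, 1) / \<delta>.\<close>
  define z where "z = (\<lambda>t x. - (x0 + \<mu> * t0) / \<delta> + \<mu> / \<delta> * t + 1 / \<delta> * x)"
  have z: "z t x = (x - x0 + \<mu> * (t - t0)) / \<delta>" for t x
    using \<delta>(1) by (simp add: z_def field_simps)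
  define \<eta> where "\<eta> = (\<lambda>t x. p (z t x) * q (- t0 + 1 * t + 0 * x))"
  have smooth: "smooth_strip T \<eta>"
    unfolding smooth_strip_def \<eta>_def z_def
    by (intro allI Ck_strip_mult[OF T] Ck_strip_compose_affine[OF T] p(1) q(1))
  have \<eta>: "\<eta> t x = p (z t x) * q (t - t0)" for t x by (simp add: \<eta>_def)
  \<comment> \<open>This is \<mu> P + S with P equal to \<open>d_x \<eta>\<close> and S the cutoff
    error, the decomposition expected by \<open>quadratic_form_bound\<close>.\<close>
  have dt: "d_t T \<eta> t x = \<mu> * (deriv p (z t x) * q (t - t0) / \<delta>) + p (z t x) * deriv q (t - t0)"
    if "t \<in> {0..T}" for t x
  proof (rule d_t_eqI[OF T that])
    have "((\<lambda>s. p (z s x)) has_real_derivative deriv p (z t x) * (\<mu> / \<delta>)) (at t within {0..T})"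
      by (rule DERIV_chain2[OF smooth_real_has_deriv[OF p(1)]])
         (use \<delta>(1) in \<open>auto simp: z_def intro!: derivative_eq_intros\<close>)
    moreover have "((\<lambda>s. q (s - t0)) has_real_derivative deriv q (t - t0) * 1) (at t within {0..T})"
      by (rule DERIV_chain2[OF smooth_real_has_deriv[OF q(1)]]) (auto intro!: derivative_eq_intros)
    ultimately show "((\<lambda>s. \<eta> s x) has_real_derivative
      \<mu> * (deriv p (z t x) * q (t - t0) / \<delta>) + p (z t x) * deriv q (t - t0)) (at t within {0..T})"
      unfolding \<eta> by (rule DERIV_cong[OF DERIV_mult]) (simp add: algebra_simps)
  qed
  have dx: "d_x \<eta> t x = deriv p (z t x) * q (t - t0) / \<delta>" for t x
  proof (rule d_x_eqI)
    have "((\<lambda>x. p (z t x)) has_real_derivative deriv p (z t x) * (1 / \<delta>)) (at x)"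
      by (rule DERIV_chain2[OF smooth_real_has_deriv[OF p(1)]])
         (use \<delta>(1) in \<open>auto simp: z_def intro!: derivative_eq_intros\<close>)
    then have "((\<lambda>x. p (z t x) * q (t - t0)) has_real_derivative
        deriv p (z t x) * (1 / \<delta>) * q (t - t0)) (at x)"
      by (rule DERIV_cmult_right)
    moreover have "\<eta> t = (\<lambda>x. p (z t x) * q (t - t0))" by (simp add: \<eta> fun_eq_iff)
    ultimately show "(\<eta> t has_real_derivative deriv p (z t x) * q (t - t0) / \<delta>) (at x)" by simp
  qed
  \<comment> \<open>Inside the slanted strip x - x0 differs from -\<mu> (t - t0) by less than
    \<delta>. As |\<mu>| <= 1, both contributions to |x - x0| are at most \<rho>/2.\<close>
  have outside: "\<rho> / 2 \<le> \<bar>t - t0\<bar> \<or> 1 \<le> \<bar>z t x\<bar>" if "\<not> (\<bar>t - t0\<bar> < \<rho> \<and> \<bar>x - x0\<bar> < \<rho>)" for t x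
  proof (rule ccontr)
    assume neg: "\<not> (\<rho> / 2 \<le> \<bar>t - t0\<bar> \<or> 1 \<le> \<bar>z t x\<bar>)"
    define y where "y = \<mu> * (t - t0)"
    have "\<bar>x - x0 + y\<bar> < \<delta>" using neg \<delta>(1) by (simp add: z y_def abs_divide)
    moreover have "\<bar>y\<bar> < \<rho> / 2"
    proof -
      have "\<bar>y\<bar> \<le> 1 * \<bar>t - t0\<bar>"
        unfolding y_def abs_mult by (rule mult_right_mono[OF \<mu>1]) simp
      also have "\<dots> < \<rho> / 2" using neg by simp
      finally show ?thesis .
    qed
    ultimately have "\<bar>x - x0\<bar> < \<rho>" using \<delta>(2) by linarith
    then show False using that neg \<rho>(1) by auto
  qed

  have zero: "p (z t x) * q (t - t0) = 0 \<and> deriv p (z t x) * q (t - t0) = 0 \<and> p (z t x) * deriv q (t - t0) = 0"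
    if "\<not> (\<bar>t - t0\<bar> < \<rho> \<and> \<bar>x - x0\<bar> < \<rho>)" for t x
    using outside[OF that] p(2)[of "z t x"] q(2)[of "t - t0"] p'[of "z t x"] q'[of "t - t0"] by auto
  have far: "\<not> (\<bar>t - t0\<bar> < \<rho> \<and> \<bar>x - x0\<bar> < \<rho>)" if "\<bar>x0\<bar> + \<rho> < \<bar>x\<bar>" for t x using that by linarith

  show thesis
  proof
    show "\<eta> \<in> schwartz_strip T"
    proof (rule schwartz_strip_compact_support[OF T smooth])
      show "\<eta> t x = 0" if "t \<in> {0..T}" "\<bar>x0\<bar> + \<rho> < \<bar>x\<bar>" for t x
        using zero[OF far[OF that(2)]] by (simp add: \<eta>)
    qed
    show "\<eta> 0 x = 0" "\<eta> T x = 0" for x using q(2) t0 \<rho> by (auto simp: \<eta>)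
    show "v t0 x0 / 2 \<le> v t x" if "t \<in> {0..T}" "d_x \<eta> t x \<noteq> 0" for t x
    proof -
      have "\<bar>t - t0\<bar> < \<rho> \<and> \<bar>x - x0\<bar> < \<rho>"
        using that(2) zero[of t x] by (auto simp: dx)
      then have "\<bar>v t x - w\<bar> \<le> w / 2" using near(2) that(1) by blast
      then show ?thesis unfolding w_def by linarith
    qed
    let ?Q = "\<lambda>t x. d_t T \<eta> t x * (d_t T \<eta> t x * v t x) + 2 * (u t x * (d_t T \<eta> t x * d_x \<eta> t x))"
    let ?H = "\<lambda>t x. - (\<kappa> / 2) * (deriv p (z t x) * q (t - t0) / \<delta>)\<^sup>2 + K * (p (z t x) * deriv q (t - t0))\<^sup>2"
    show "strip_integral T ?Q < 0"
    proof -
      have decay: "strip_decay T f" if "smooth_strip T f"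
        "\<And>t x. t \<in> {0..T} \<Longrightarrow> \<bar>x0\<bar> + \<rho> < \<bar>x\<bar> \<Longrightarrow> f t x = 0" for f
      proof -
        have "f \<in> schwartz_strip T" using schwartz_strip_compact_support[OF T that] .
        from schwartz_strip_bound[OF this, of 1 0 0] obtain C where
          "\<And>t x. t \<in> {0..T} \<Longrightarrow> (1 + x\<^sup>2) ^ 1 * \<bar>(d_x ^^ 0) ((d_t T ^^ 0) f) t x\<bar> \<le> C" by blast
        then have "\<forall>t\<in>{0..T}. \<forall>x. \<bar>f t x\<bar> \<le> C * inverse (1 + x\<^sup>2)"
          by (simp add: field_simps add_pos_nonneg)
        then show ?thesis using smooth_strip_continuous[OF that(1)] unfolding strip_decay_def by blast
      qed
      have a: "strip_decay T (d_t T \<eta>)"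
      proof (rule decay[OF smooth_strip_d_t[OF smooth]])
        show "d_t T \<eta> t x = 0" if "t \<in> {0..T}" "\<bar>x0\<bar> + \<rho> < \<bar>x\<bar>" for t x
          unfolding dt[OF that(1)] using zero[of t x, OF far[OF that(2)]] by auto
      qed
      have b: "strip_decay T (d_x \<eta>)"
      proof (rule decay[OF smooth_strip_d_x[OF smooth]])
        show "d_x \<eta> t x = 0" if "t \<in> {0..T}" "\<bar>x0\<bar> + \<rho> < \<bar>x\<bar>" for t x
          unfolding dx using zero[of t x, OF far[OF that(2)]] by auto
      qed
      have P: "strip_decay T (\<lambda>t x. deriv p (z t x) * q (t - t0))"
      proof (rule decay)
        have "smooth_strip T (\<lambda>t x. deriv p (z t x) * q (- t0 + 1 * t + 0 * x))"
          unfolding smooth_strip_def z_def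
          by (intro allI Ck_strip_mult[OF T] Ck_strip_compose_affine[OF T] smooth_real_deriv p(1) q(1))
        then show "smooth_strip T (\<lambda>t x. deriv p (z t x) * q (t - t0))" by simp
      qed (use zero[OF far] in blast)
      have S: "strip_decay T (\<lambda>t x. p (z t x) * deriv q (t - t0))"
      proof (rule decay)
        have "smooth_strip T (\<lambda>t x. p (z t x) * deriv q (- t0 + 1 * t + 0 * x))"
          unfolding smooth_strip_def z_def
          by (intro allI Ck_strip_mult[OF T] Ck_strip_compose_affine[OF T] smooth_real_deriv p(1) q(1))
        then show "smooth_strip T (\<lambda>t x. p (z t x) * deriv q (t - t0))" by simp
      qed (use zero[OF far] in blast)
      let ?PP = "\<lambda>t x. deriv p (z t x) * q (t - t0) * (deriv p (z t x) * q (t - t0))"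
      let ?SS = "\<lambda>t x. p (z t x) * deriv q (t - t0) * (p (z t x) * deriv q (t - t0)) * K"
      have PP: "strip_decay T ?PP" and SS: "strip_decay T ?SS"
        by (intro strip_decay_mult P S strip_decay_imp_bounded strip_bounded_const)+
      have H: "?H = (\<lambda>t x. ?SS t x + (- (\<kappa> / (2 * \<delta>\<^sup>2))) * ?PP t x)"
        by (intro ext) (simp add: power2_eq_square)
      \<comment> \<open>The pointwise bound needs u and v near their values at the centre, so it
        applies only in the box; elsewhere both sides vanish.\<close>
      have le: "?Q t x \<le> ?H t x" if t: "t \<in> {0..T}" for t x
      proof (cases "\<bar>t - t0\<bar> < \<rho> \<and> \<bar>x - x0\<bar> < \<rho>")
        case True
        let ?P = "deriv p (z t x) * q (t - t0) / \<delta>" and ?S = "p (z t x) * deriv q (t - t0)"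
        have "?Q t x = v t x * (\<mu> * ?P + ?S)\<^sup>2 + 2 * u t x * (\<mu> * ?P + ?S) * ?P"
          unfolding dt[OF t] dx by (simp only: power2_eq_square mult_ac)
        also have "\<dots> \<le> ?H t x"
          using near[OF t, of x] True
          by (intro quadratic_form_bound[OF c _ _ w m \<mu>_def \<kappa>_def K_def]) auto
        finally show ?thesis .
      next
        case False
        note zero' = zero[OF this, THEN conjunct1] zero[OF this, THEN conjunct2, THEN conjunct1]
          zero[OF this, THEN conjunct2, THEN conjunct2]
        show ?thesis unfolding dt[OF t] dx zero' by simp
      qed
      have Q: "strip_decay T ?Q"
      proof (rule strip_decay_add_cmult)
        show "strip_decay T (\<lambda>t x. d_t T \<eta> t x * (d_t T \<eta> t x * v t x))"
          by (intro strip_decay_mult strip_decay_imp_bounded a vb)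
        have "strip_decay T (\<lambda>t x. d_t T \<eta> t x * d_x \<eta> t x * u t x)"
          by (intro strip_decay_mult strip_decay_imp_bounded a b ub)
        then show "strip_decay T (\<lambda>t x. u t x * (d_t T \<eta> t x * d_x \<eta> t x))"
          by (simp only: mult.commute)
      qed
      \<comment> \<open>For fixed t the map \<open>z t\<close> has slope 1/\<delta>; the Jacobian
        \<delta> accounts for the small area of the strip.\<close>
      have scale: "(LBINT x. f (z t x)) = \<delta> * (LBINT x. f x)" for f :: "real \<Rightarrow> real" and t
        using lborel_integral_real_affine[of "1 / \<delta>" f "- (x0 + \<mu> * t0) / \<delta> + \<mu> / \<delta> * t"] \<delta>(1)
        by (simp add: z_def)
      have "strip_integral T ?PP = (LBINT t:{0..T}. (\<delta> * A) * (q (t - t0))\<^sup>2)"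
        unfolding strip_integral_def
      proof (intro set_lebesgue_integral_cong ballI allI impI)
        fix t
        have "(LBINT x. ?PP t x) = (LBINT x. (\<lambda>y. (deriv p y)\<^sup>2 * (q (t - t0))\<^sup>2) (z t x))"
          by (simp add: power2_eq_square mult_ac)
        also have "\<dots> = \<delta> * A * (q (t - t0))\<^sup>2" by (subst scale) (simp add: A_def)
        finally show "(LBINT x. ?PP t x) = \<delta> * A * (q (t - t0))\<^sup>2" .
      qed simp
      then have intPP: "strip_integral T ?PP = \<delta> * A * A2" by (simp add: A2_def)
      have "strip_integral T ?SS = (LBINT t:{0..T}. (\<delta> * B * K) * (deriv q (t - t0))\<^sup>2)"
        unfolding strip_integral_def
      proof (intro set_lebesgue_integral_cong ballI allI impI)
        fix t
        have "(LBINT x. ?SS t x) = (LBINT x. (\<lambda>y. (p y)\<^sup>2 * ((deriv q (t - t0))\<^sup>2 * K)) (z t x))"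
          by (simp add: power2_eq_square mult_ac)
        also have "\<dots> = \<delta> * B * K * (deriv q (t - t0))\<^sup>2" by (subst scale) (simp add: B_def)
        finally show "(LBINT x. ?SS t x) = \<delta> * B * K * (deriv q (t - t0))\<^sup>2" .
      qed simp
      then have intSS: "strip_integral T ?SS = \<delta> * B * K * B2" by (simp add: B2_def)
      have "strip_integral T ?Q \<le> strip_integral T ?H"
      proof (rule strip_integral_mono[OF Q _ le])
        show "strip_decay T ?H" by (subst H) (rule strip_decay_add_cmult[OF SS PP])
      qed
      also have "\<dots> = \<delta> * B * K * B2 - \<kappa> / (2 * \<delta>\<^sup>2) * (\<delta> * A * A2)"
      proof -
        have "strip_integral T ?H = strip_integral T ?SS + (- (\<kappa> / (2 * \<delta>\<^sup>2))) * strip_integral T ?PP"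
          by (subst H) (rule strip_integral_add_cmult[OF SS PP])
        then show ?thesis unfolding intPP intSS by simp
      qed
      also have "\<dots> = (\<delta>\<^sup>2 * (K * B * B2) - M) / \<delta>"
        using \<delta>(1) by (simp add: M_def field_simps power2_eq_square)
      also have "\<dots> < 0" using small \<delta>(1) by (simp add: divide_neg_pos)
      finally show ?thesis .
    qed
  qed
qed

subsection \<open>Perturbing the path\<close>

text \<open>The mean value theorem in time at a fixed x gives a time strictly inside (0, t), which
  leaves room for a bump vanishing at both end times.\<close>

lemma path_velocity_nonzero:
  assumes T: "0 < T" and sm: "smooth_strip T \<phi>" and t: "t \<in> {0..T}" "\<phi> t \<noteq> \<phi> 0"
  obtains t0 x0 where "0 < t0" "t0 < T" "d_t T \<phi> t0 x0 \<noteq> 0"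
proof -
  obtain x where x: "\<phi> t x \<noteq> \<phi> 0 x" using t(2) by auto
  have "0 < t" using t x by (cases "t = 0") auto
  have "\<exists>s\<in>{0<..<t}. \<phi> t x - \<phi> 0 x = d_t T \<phi> s x * (t - 0)"
  proof (rule mvt_simple[OF \<open>0 < t\<close>])
    fix s assume s: "0 \<le> s" "s \<le> t"
    have "((\<lambda>s. \<phi> s x) has_real_derivative d_t T \<phi> s x) (at s within {0..t})"
      by (rule DERIV_subset[OF smooth_strip_deriv_t[OF sm]]) (use s t(1) in auto)
    then show "((\<lambda>s. \<phi> s x) has_derivative (*) (d_t T \<phi> s x)) (at s within {0..t})"
      by (simp add: has_field_derivative_def)
  qed
  then obtain s where s: "0 < s" "s < t" and eq: "\<phi> t x - \<phi> 0 x = d_t T \<phi> s x * t" by auto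
  then have "d_t T \<phi> s x \<noteq> 0" using x by auto
  then show ?thesis using that[of s x] s t(1) by auto
qed

lemma schwartz_strip_decay_d_t:
  assumes "h \<in> schwartz_strip T"
  shows "strip_decay T (d_t T h)"
proof -
  obtain C where C: "\<And>t x. t \<in> {0..T} \<Longrightarrow> (1 + x\<^sup>2) ^ 1 * \<bar>(d_x ^^ 0) ((d_t T ^^ 1) h) t x\<bar> \<le> C"
    using schwartz_strip_bound[OF assms] by blast
  have "\<bar>d_t T h t x\<bar> \<le> C * inverse (1 + x\<^sup>2)" if "t \<in> {0..T}" for t x
    using C[OF that, of x] by (simp add: field_simps add_pos_nonneg)
  moreover have "smooth_strip T (d_t T h)"
    using assms smooth_strip_d_t by (auto simp: schwartz_strip_def)
  ultimately show ?thesis using smooth_strip_continuous unfolding strip_decay_def by blast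
qed

lemma schwartz_strip_bounded_d_x:
  assumes "h \<in> schwartz_strip T"
  obtains C where "0 \<le> C" "\<And>t x. t \<in> {0..T} \<Longrightarrow> \<bar>d_x h t x\<bar> \<le> C"
proof -
  obtain C where "0 \<le> C" "\<And>t x. t \<in> {0..T} \<Longrightarrow> (1 + x\<^sup>2) ^ 0 * \<bar>(d_x ^^ 1) ((d_t T ^^ 0) h) t x\<bar> \<le> C"
    using schwartz_strip_bound[OF assms] by blast
  then show ?thesis using that by auto
qed

text \<open>Smoothness and decay are preserved by linearity, so positivity of the x-derivative is
  the only condition left for being a path of diffeomorphisms.\<close>

lemma diff_paths_perturb:
  assumes T: "0 < T" and \<phi>: "\<phi> \<in> diff_paths T" and \<eta>: "\<eta> \<in> schwartz_strip T"
    and pos: "\<And>t x. t \<in> {0..T} \<Longrightarrow> 0 < d_x \<phi> t x + e * d_x \<eta> t x"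
  shows "(\<lambda>t x. \<phi> t x + e * \<eta> t x) \<in> diff_paths T"
proof -
  define \<psi> where "\<psi> = (\<lambda>t x. \<phi> t x + e * \<eta> t x)"
  have sm: "smooth_strip T \<phi>" "smooth_strip T \<eta>" and h: "(\<lambda>t x. \<phi> t x - x) \<in> schwartz_strip T"
    using \<phi> \<eta> by (auto simp: diff_paths_def schwartz_strip_def)
  have sm\<psi>: "smooth_strip T \<psi>" unfolding \<psi>_def by (rule smooth_strip_add_cmult[OF T sm])
  have "(\<lambda>t x. (\<phi> t x - x) + e * \<eta> t x) \<in> schwartz_strip T"
    by (rule schwartz_strip_add_cmult[OF T h \<eta>])
  moreover have "(\<lambda>t x. (\<phi> t x - x) + e * \<eta> t x) = (\<lambda>t x. \<psi> t x - x)"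
    by (intro ext) (simp add: \<psi>_def)
  ultimately have h\<psi>: "(\<lambda>t x. \<psi> t x - x) \<in> schwartz_strip T" by simp
  have "\<psi> t \<in> Diff_S" if t: "t \<in> {0..T}" for t
  proof (rule Diff_S_I)
    show "(\<lambda>x. \<psi> t x - x) \<in> schwartz" using schwartz_strip_slice[OF h\<psi> t] .
    show "smooth_real (\<psi> t)" by (rule smooth_strip_slice[OF sm\<psi> t])
    show "0 < deriv (\<psi> t) x" for x
      using pos[OF t, of x] d_x_add_cmult[OF sm t, of e x] by (simp add: \<psi>_def d_x_def)
  qed simp
  then show ?thesis using sm\<psi> h\<psi> by (simp add: diff_paths_def \<psi>_def)
qed

lemma cubic_negative_nearby:
  fixes I1 I2 I3 d :: real
  assumes "I2 < 0" "0 < d"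
  obtains e where "\<bar>e\<bar> < d" "e * I1 + e\<^sup>2 * I2 + e ^ 3 * I3 < 0"
proof -
  \<comment> \<open>For |e| <= r the cubic term is at most half the size of the quadratic
    one.\<close>
  define r where "r = min (d / 2) (- I2 / (2 * (\<bar>I3\<bar> + 1)))"
  have "0 < - I2 / (2 * (\<bar>I3\<bar> + 1))" using assms(1) by (intro divide_pos_pos) auto
  then have r: "0 < r" "r < d" "r \<le> - I2 / (2 * (\<bar>I3\<bar> + 1))" using assms by (auto simp: r_def)
  define e where "e = (if 0 \<le> I1 then - r else r)"
  have abs_e: "\<bar>e\<bar> = r" using r by (simp add: e_def)
  have "e * I1 \<le> 0" using r by (simp add: e_def mult_nonneg_nonpos)
  moreover have "e\<^sup>2 * I2 + e ^ 3 * I3 < 0"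
  proof -
    have "e * I3 \<le> r * \<bar>I3\<bar>" using abs_ge_self[of "e * I3"] by (simp add: abs_mult abs_e)
    also have "\<dots> \<le> r * (\<bar>I3\<bar> + 1)" using r by simp
    also have "\<dots> \<le> - I2 / 2" using r(3) by (simp add: field_simps)
    also have "\<dots> < - I2" using assms(1) by simp
    finally have "e\<^sup>2 * (I2 + e * I3) < 0" using r abs_e by (intro mult_pos_neg) auto
    then show ?thesis by (simp add: power2_eq_square power3_eq_cube algebra_simps)
  qed
  ultimately have "e * I1 + e\<^sup>2 * I2 + e ^ 3 * I3 < 0" by linarith
  then show ?thesis using that[of e] abs_e r by simp
qed

theorem theorem3p1:
  fixes T :: real and \<phi> :: "real \<Rightarrow> real \<Rightarrow> real" and U :: "(real \<Rightarrow> real \<Rightarrow> real) set"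
  assumes "0 < T"
    and "\<phi> \<in> diff_paths T"
    and "\<exists>t\<in>{0..T}. \<phi> t \<noteq> \<phi> 0"
    and "\<exists>V. openin (diff_path_topology T) V \<and> \<phi> \<in> V \<and> V \<subseteq> U"
  shows "\<exists>\<psi>\<in>diff_paths T. \<psi> \<in> U \<and> \<psi> 0 = \<phi> 0 \<and> \<psi> T = \<phi> T \<and> energy T \<psi> < energy T \<phi>"
proof -
  note T = assms(1)
  have sm: "smooth_strip T \<phi>" and h: "(\<lambda>t x. \<phi> t x - x) \<in> schwartz_strip T"
    using assms(2) by (auto simp: diff_paths_def)
  have smh: "smooth_strip T (\<lambda>t x. \<phi> t x - x)" using h by (simp add: schwartz_strip_def)
  \<comment> \<open>Decay and bounds are available only for \<phi> - x; these identities carry them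
    over to the derivatives of \<phi>.\<close>
  have dt_h: "d_t T (\<lambda>t x. \<phi> t x - x) t x = d_t T \<phi> t x"
    and dx_h: "d_x (\<lambda>t x. \<phi> t x - x) t x = d_x \<phi> t x - 1" if "t \<in> {0..T}" for t x
    using DERIV_diff[OF smooth_strip_deriv_t[OF sm that] DERIV_const, THEN d_t_eqI[OF T that, where h = "\<lambda>t x. \<phi> t x - x"]]
      DERIV_diff[OF smooth_strip_deriv_x[OF sm that] DERIV_ident, THEN d_x_eqI[where h = "\<lambda>t x. \<phi> t x - x"]]
    by auto
  have dpos: "0 < d_x \<phi> t x" if "t \<in> {0..T}" for t x
    using assms(2) that Diff_S_deriv_pos by (auto simp: diff_paths_def d_x_def)
  have u: "strip_decay T (d_t T \<phi>)"
    using schwartz_strip_decay_d_t[OF h] smooth_strip_continuous[OF smooth_strip_d_t[OF sm]]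
    by (auto simp: strip_decay_def dt_h)
  have v: "strip_bounded T (d_x \<phi>)"
  proof -
    obtain C where C: "\<And>t x. t \<in> {0..T} \<Longrightarrow> \<bar>d_x (\<lambda>t x. \<phi> t x - x) t x\<bar> \<le> C"
      using schwartz_strip_bounded_d_x[OF h] by blast
    have "\<bar>d_x \<phi> t x\<bar> \<le> C + 1" if "t \<in> {0..T}" for t x
      using C[OF that, of x] dx_h[OF that, of x] by linarith
    then show ?thesis
      using smooth_strip_continuous[OF smooth_strip_d_x[OF sm]] unfolding strip_bounded_def by blast
  qed
  obtain t0 x0 where t0: "0 < t0" "t0 < T" and u0: "d_t T \<phi> t0 x0 \<noteq> 0"
    using path_velocity_nonzero[OF T sm] assms(3) by blast
  have v0: "0 < d_x \<phi> t0 x0" using dpos t0 by simp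
  obtain \<eta> where \<eta>: "\<eta> \<in> schwartz_strip T" "\<And>x. \<eta> 0 x = 0" "\<And>x. \<eta> T x = 0"
    and supp: "\<And>t x. t \<in> {0..T} \<Longrightarrow> d_x \<eta> t x \<noteq> 0 \<Longrightarrow> d_x \<phi> t0 x0 / 2 \<le> d_x \<phi> t x"
    and neg: "strip_integral T (\<lambda>t x. d_t T \<eta> t x * (d_t T \<eta> t x * d_x \<phi> t x)
       + 2 * (d_t T \<phi> t x * (d_t T \<eta> t x * d_x \<eta> t x))) < 0"
    using negative_direction_exists[OF T t0 strip_decay_imp_bounded[OF u] v u0 v0] by blast
  have sm\<eta>: "smooth_strip T \<eta>" using \<eta>(1) by (simp add: schwartz_strip_def)
  obtain C where C: "0 \<le> C" "\<And>t x. t \<in> {0..T} \<Longrightarrow> \<bar>d_x \<eta> t x\<bar> \<le> C"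
    using schwartz_strip_bounded_d_x[OF \<eta>(1)] by blast
  have b: "strip_bounded T (d_x \<eta>)"
    using C smooth_strip_continuous[OF smooth_strip_d_x[OF sm\<eta>]] unfolding strip_bounded_def by blast

  obtain V where V: "openin (diff_path_topology T) V" "\<phi> \<in> V" "V \<subseteq> U" using assms(4) by blast
  then obtain W where W: "openin (schwartz_strip_topology T) W"
    "V = (\<lambda>\<phi> t x. \<phi> t x - x) -` W \<inter> diff_paths T"
    unfolding diff_path_topology_def openin_pullback_topology by blast
  then have "(\<lambda>t x. \<phi> t x - x) \<in> W" using V(2) by blast
  from schwartz_strip_topology_line[OF T W(1) this \<eta>(1)] obtain d1 where d1: "0 < d1"
    "\<And>c. \<bar>c\<bar> < d1 \<Longrightarrow> (\<lambda>t x. \<phi> t x - x + c * \<eta> t x) \<in> W" by blast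
  \<comment> \<open>For |e| < d2 the change of \<open>d_x \<phi>\<close> is less than half its value
    at (t0, x0), which by \<open>supp\<close> is a lower bound wherever \<open>d_x \<eta>\<close> is
    nonzero. Elsewhere \<open>d_x \<phi>\<close> is unchanged.\<close>
  define d2 where "d2 = d_x \<phi> t0 x0 / (2 * (C + 1))"
  have d2: "0 < d2" using v0 C(1) by (simp add: d2_def)
  have pos: "0 < d_x \<phi> t x + e * d_x \<eta> t x" if e: "\<bar>e\<bar> < d2" and t: "t \<in> {0..T}" for e t x
  proof (cases "d_x \<eta> t x = 0")
    case True
    then show ?thesis using dpos[OF t] by simp
  next
    case False
    have "\<bar>e * d_x \<eta> t x\<bar> \<le> \<bar>e\<bar> * (C + 1)"
      unfolding abs_mult using C(2)[OF t, of x] by (intro mult_left_mono) auto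
    also have "\<dots> < d2 * (C + 1)" using e C(1) by simp
    also have "\<dots> = d_x \<phi> t0 x0 / 2"
      using C(1) nonzero_mult_div_cancel_right[of "C + 1"] by (simp add: d2_def divide_simps)
    finally show ?thesis using supp[OF t False] by linarith
  qed

  obtain I1 I3 where expand: "\<And>e. strip_integral T
      (\<lambda>t x. (d_t T \<phi> t x + e * d_t T \<eta> t x)\<^sup>2 * (d_x \<phi> t x + e * d_x \<eta> t x)) =
      strip_integral T (\<lambda>t x. (d_t T \<phi> t x)\<^sup>2 * d_x \<phi> t x) + e * I1
      + e\<^sup>2 * strip_integral T (\<lambda>t x. d_t T \<eta> t x * (d_t T \<eta> t x * d_x \<phi> t x)
          + 2 * (d_t T \<phi> t x * (d_t T \<eta> t x * d_x \<eta> t x)))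
      + e ^ 3 * I3"
    using strip_integral_energy_expand[OF u schwartz_strip_decay_d_t[OF \<eta>(1)] v b] by blast
  \<comment> \<open>\<open>d1\<close> keeps the perturbation in the given neighbourhood,
    \<open>d2\<close> keeps it a path of diffeomorphisms.\<close>
  have "0 < min d1 d2" using d1 d2 by simp
  from cubic_negative_nearby[OF neg this] obtain e where e: "\<bar>e\<bar> < min d1 d2"
    and dec: "e * I1 + e\<^sup>2 * strip_integral T (\<lambda>t x. d_t T \<eta> t x * (d_t T \<eta> t x * d_x \<phi> t x)
          + 2 * (d_t T \<phi> t x * (d_t T \<eta> t x * d_x \<eta> t x))) + e ^ 3 * I3 < 0"
    by blast
  define \<psi> where "\<psi> = (\<lambda>t x. \<phi> t x + e * \<eta> t x)"
  have \<psi>: "\<psi> \<in> diff_paths T"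
    unfolding \<psi>_def using e by (intro diff_paths_perturb[OF T assms(2) \<eta>(1)] pos) auto
  moreover have "\<psi> \<in> U"
  proof -
    have "(\<lambda>t x. \<phi> t x - x + e * \<eta> t x) = (\<lambda>t x. \<psi> t x - x)"
      by (intro ext) (simp add: \<psi>_def)
    then have "(\<lambda>t x. \<psi> t x - x) \<in> W" using d1(2)[of e] e by simp
    then show ?thesis using W(2) \<psi> V(3) by blast
  qed
  moreover have "\<psi> 0 = \<phi> 0" "\<psi> T = \<phi> T" by (simp_all add: \<psi>_def \<eta>(2,3))
  moreover have "energy T \<psi> < energy T \<phi>"
  proof -
    have "energy T \<psi> = strip_integral T
      (\<lambda>t x. (d_t T \<phi> t x + e * d_t T \<eta> t x)\<^sup>2 * (d_x \<phi> t x + e * d_x \<eta> t x))"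
      unfolding energy_def strip_integral_def \<psi>_def
      by (rule set_lebesgue_integral_cong)
         (auto simp: d_t_add_cmult[OF T sm sm\<eta>] d_x_add_cmult[OF sm sm\<eta>])
    also have "\<dots> < energy T \<phi>"
      unfolding expand using dec by (simp add: energy_def strip_integral_def)
    finally show ?thesis .
  qed
  ultimately show ?thesis by blast
qed

end
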